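(* Let $\mathbb A$ be a three-dimensional algebra with unit $e$ and $F=(f_1,f_2,f_3)$ an $\mathbb A$-algebrizable vector field defined on an open set $\Omega\subset\mathbb R^3$. For $0\le\theta\le2\pi$, $0\le\phi\le\pi$ let $F_{\theta,\phi}=u_{\theta,\phi}F$ be the product with respect to $\mathbb A$ of $u_{\theta,\phi}=(\cos\theta\sin\phi,\sin\theta\sin\phi,\cos\phi)$ and $F$, and let $\mathcal F=\{F_{\theta,\phi}:0\le\theta\le2\pi,\ 0\le\phi\le\pi\}$. Then the vector fields in $\mathcal F$ are geodesible (on $\Omega(F,\mathbb A^* )$) with respect to the Riemannian metric $g=\frac{1}{\|e\|^2}H^*\lambda$, and, with $E_i=e_iF$ (product in $\mathbb A$) for $i=1,2,3$, $$\{E_1,E_2,E_3\}=\{F_{0,\pi/2},F_{\pi/2,\pi/2},F_{0,0}\}.$$ Moreover, $\mathcal F$ is commutative with respect to the Lie bracket.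
   Context: A three-dimensional algebra $\mathbb A$ is the linear space $\mathbb R^3$ (canonical basis $e_1,e_2,e_3$) endowed with a bilinear, associative, commutative product with unit $e$. $\mathbb A^*$ is the set of regular (invertible) elements; the inverse of $a$ is written $\frac ea$. A vector field $F:\Omega\to\mathbb R^3$ is $\mathbb A$-algebrizable if there is $F':\Omega\to\mathbb R^3$ with $\lim_{\xi\to0}|F(w+\xi)-F(w)-F'(w)\xi|/|\xi|=0$ for all $w\in\Omega$ (product in $\mathbb A$). $\Omega(F,\mathbb A^* )=F^{-1}(\mathbb A^* )$. A vector field is geodesible with respect to a Riemannian metric if its integral curves are unitary (unit-speed) geodesics of that metric. $H$ is the (possibly multivalued) function on $\Omega(F,\mathbb A^* )$ given locally by $H(w)=\int_\gamma\frac eF\,d\xi:=\int_0^a\frac e{F(\gamma(t))}\dot\gamma(t)\,dt$ (product in $\mathbb A$), where $\gamma:[0,a]\to\Omega(F,\mathbb A^* )$ is a differentiable curve from a base point $w_0$ (one fixed in each connected component) to $w$; its local branches differ by constants, so the pullback $H^*\lambda$ is well defined. $\|e\|$ is the Euclidean norm of $e$, and $\lambda$ ($\lambda_{ij}=\delta_{ij}$) is the natural Riemannian metric of $\mathbb R^3$. The Lie bracket is $[K_1,K_2](w)=dK_2(w)(K_1(w))-dK_1(w)(K_2(w))$; a family is commutative with respect to it if the bracket of each pair of its members is zero.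
   Formalization: Unit speed fails if ‖e‖≠1, as g(uF,uF)=1/‖e‖²; proved instead: integral curves of each F_{θ,φ} are geodesics of g of constant speed 1/‖e‖, unit-speed when ‖e‖=1. The metric g is only required to have differentiable coefficients, as F is merely differentiable. *)

theory Defs
  imports "HOL-Analysis.Analysis"
begin

type_synonym vec3 = "real ^ 3"
type_synonym product3 = "vec3 \<Rightarrow> vec3 \<Rightarrow> vec3"
type_synonym metric3 = "vec3 \<Rightarrow> vec3 \<Rightarrow> vec3 \<Rightarrow> real"

section \<open>Three-dimensional algebras and algebrizable vector fields\<close>

definition algebra3 :: "product3 \<Rightarrow> vec3 \<Rightarrow> bool" where
  "algebra3 m e \<longleftrightarrow>
     bilinear m \<and>
     (\<forall>x y z. m (m x y) z = m x (m y z)) \<and>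
     (\<forall>x y. m x y = m y x) \<and>
     (\<forall>x. m e x = x)"

definition regular :: "product3 \<Rightarrow> vec3 \<Rightarrow> vec3 \<Rightarrow> bool" where
  "regular m e a \<longleftrightarrow> (\<exists>b. m a b = e)"

definition alg_inverse :: "product3 \<Rightarrow> vec3 \<Rightarrow> vec3 \<Rightarrow> vec3" where
  "alg_inverse m e a = (THE b. m a b = e)"

definition algebrizable_on :: "product3 \<Rightarrow> vec3 set \<Rightarrow> (vec3 \<Rightarrow> vec3) \<Rightarrow> bool" where
  "algebrizable_on m \<Omega> F \<longleftrightarrow>
     (\<exists>F'. \<forall>w\<in>\<Omega>. (F has_derivative (\<lambda>\<xi>. m (F' w) \<xi>)) (at w))"

definition regular_domain :: "product3 \<Rightarrow> vec3 \<Rightarrow> (vec3 \<Rightarrow> vec3) \<Rightarrow> vec3 set \<Rightarrow> vec3 set" where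
  "regular_domain m e F \<Omega> = {w \<in> \<Omega>. regular m e (F w)}"

section \<open>The multivalued function H and the metric it induces\<close>

definition curve_in :: "vec3 set \<Rightarrow> real \<Rightarrow> (real \<Rightarrow> vec3) \<Rightarrow> bool" where
  "curve_in S a \<gamma> \<longleftrightarrow> 0 \<le> a \<and> \<gamma> differentiable_on {0..a} \<and> \<gamma> ` {0..a} \<subseteq> S"

text \<open>The integral is the gauge integral, so that every differentiable curve is admissible,
  without any continuity assumption on its derivative.\<close>

definition has_line_integral ::
  "product3 \<Rightarrow> vec3 \<Rightarrow> (vec3 \<Rightarrow> vec3) \<Rightarrow> real \<Rightarrow> (real \<Rightarrow> vec3) \<Rightarrow> vec3 \<Rightarrow> bool" where
  "has_line_integral m e F a \<gamma> I \<longleftrightarrow>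
     ((\<lambda>t. m (alg_inverse m e (F (\<gamma> t))) (vector_derivative \<gamma> (at t within {0..a})))
        has_integral I) {0..a}"

definition base_points :: "vec3 set \<Rightarrow> (vec3 \<Rightarrow> vec3) \<Rightarrow> bool" where
  "base_points S b \<longleftrightarrow>
     (\<forall>w\<in>S. connected_component S w (b w)) \<and>
     (\<forall>w w'. connected_component S w w' \<longrightarrow> b w = b w')"

definition H_values ::
  "product3 \<Rightarrow> vec3 \<Rightarrow> (vec3 \<Rightarrow> vec3) \<Rightarrow> vec3 set \<Rightarrow> (vec3 \<Rightarrow> vec3) \<Rightarrow> vec3 \<Rightarrow> vec3 set" where
  "H_values m e F \<Omega> b w =
     {I. \<exists>a \<gamma>. curve_in (regular_domain m e F \<Omega>) a \<gamma> \<and> \<gamma> 0 = b w \<and> \<gamma> a = w \<and>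
              has_line_integral m e F a \<gamma> I}"

text \<open>A local branch of H on U picks one of the values of H at every point of U, coherently:
  continuing the branch along a curve inside U adds the line integral over that curve.\<close>

definition H_branch ::
  "product3 \<Rightarrow> vec3 \<Rightarrow> (vec3 \<Rightarrow> vec3) \<Rightarrow> vec3 set \<Rightarrow> (vec3 \<Rightarrow> vec3) \<Rightarrow>
   vec3 set \<Rightarrow> (vec3 \<Rightarrow> vec3) \<Rightarrow> bool" where
  "H_branch m e F \<Omega> b U h \<longleftrightarrow>
     open U \<and> connected U \<and> U \<subseteq> regular_domain m e F \<Omega> \<and>
     (\<forall>w\<in>U. h w \<in> H_values m e F \<Omega> b w) \<and>
     (\<forall>a \<gamma>. curve_in U a \<gamma> \<longrightarrow> has_line_integral m e F a \<gamma> (h (\<gamma> a) - h (\<gamma> 0)))"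

definition pullback_euclidean :: "(vec3 \<Rightarrow> vec3) \<Rightarrow> metric3" where
  "pullback_euclidean h w x y =
     frechet_derivative h (at w) x \<bullet> frechet_derivative h (at w) y"

text \<open>The pullback of the Euclidean metric by the multivalued function H is the common value
  of the pullbacks by the local branches of H around the point.\<close>

definition H_pullback ::
  "product3 \<Rightarrow> vec3 \<Rightarrow> (vec3 \<Rightarrow> vec3) \<Rightarrow> vec3 set \<Rightarrow> (vec3 \<Rightarrow> vec3) \<Rightarrow> metric3" where
  "H_pullback m e F \<Omega> b w x y =
     (THE r. \<exists>U h. H_branch m e F \<Omega> b U h \<and> w \<in> U \<and> r = pullback_euclidean h w x y)"

definition H_metric ::
  "product3 \<Rightarrow> vec3 \<Rightarrow> (vec3 \<Rightarrow> vec3) \<Rightarrow> vec3 set \<Rightarrow> (vec3 \<Rightarrow> vec3) \<Rightarrow> metric3" where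
  "H_metric m e F \<Omega> b w x y = 1 / (norm e)\<^sup>2 * H_pullback m e F \<Omega> b w x y"

section \<open>Riemannian metrics, geodesics and geodesible vector fields\<close>

definition gram :: "metric3 \<Rightarrow> vec3 \<Rightarrow> real ^ 3 ^ 3" where
  "gram g w = (\<chi> i j. g w (axis i 1) (axis j 1))"

text \<open>An algebrizable vector field is only assumed to be differentiable, not to be of class
  C1.  The metrics considered here inherit exactly that regularity, which is what the
  Christoffel symbols need.\<close>

definition riemannian_metric_on :: "vec3 set \<Rightarrow> metric3 \<Rightarrow> bool" where
  "riemannian_metric_on S g \<longleftrightarrow>
     (\<forall>w\<in>S. bilinear (g w) \<and> (\<forall>x y. g w x y = g w y x) \<and> (\<forall>x. x \<noteq> 0 \<longrightarrow> g w x x > 0) \<and>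
            (\<forall>i j. (\<lambda>z. gram g z $ i $ j) differentiable (at w)))"

definition gram_partial :: "metric3 \<Rightarrow> 3 \<Rightarrow> 3 \<Rightarrow> 3 \<Rightarrow> vec3 \<Rightarrow> real" where
  "gram_partial g l i j w = frechet_derivative (\<lambda>z. gram g z $ i $ j) (at w) (axis l 1)"

definition christoffel :: "metric3 \<Rightarrow> 3 \<Rightarrow> 3 \<Rightarrow> 3 \<Rightarrow> vec3 \<Rightarrow> real" where
  "christoffel g k i j w =
     1 / 2 * (\<Sum>l\<in>UNIV. matrix_inv (gram g w) $ k $ l *
       (gram_partial g i j l w + gram_partial g j i l w - gram_partial g l i j w))"

definition geodesic_with_speed :: "real \<Rightarrow> metric3 \<Rightarrow> real set \<Rightarrow> (real \<Rightarrow> vec3) \<Rightarrow> bool" where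
  "geodesic_with_speed c g J \<gamma> \<longleftrightarrow>
     (\<exists>\<gamma>' \<gamma>''. \<forall>t\<in>J.
        (\<gamma> has_vector_derivative \<gamma>' t) (at t) \<and>
        (\<gamma>' has_vector_derivative \<gamma>'' t) (at t) \<and>
        (\<forall>k. \<gamma>'' t $ k +
             (\<Sum>i\<in>UNIV. \<Sum>j\<in>UNIV. christoffel g k i j (\<gamma> t) * \<gamma>' t $ i * \<gamma>' t $ j) = 0) \<and>
        sqrt (g (\<gamma> t) (\<gamma>' t) (\<gamma>' t)) = c)"

definition integral_curve ::
  "vec3 set \<Rightarrow> (vec3 \<Rightarrow> vec3) \<Rightarrow> real set \<Rightarrow> (real \<Rightarrow> vec3) \<Rightarrow> bool" where
  "integral_curve S K J \<gamma> \<longleftrightarrow>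
     open J \<and> is_interval J \<and> \<gamma> ` J \<subseteq> S \<and> (\<forall>t\<in>J. (\<gamma> has_vector_derivative K (\<gamma> t)) (at t))"

definition geodesible_with_speed :: "real \<Rightarrow> metric3 \<Rightarrow> vec3 set \<Rightarrow> (vec3 \<Rightarrow> vec3) \<Rightarrow> bool" where
  "geodesible_with_speed c g S K \<longleftrightarrow>
     riemannian_metric_on S g \<and>
     (\<forall>J \<gamma>. integral_curve S K J \<gamma> \<longrightarrow> geodesic_with_speed c g J \<gamma>)"

text \<open>Unit speed is geodesibility proper.  The general speed is needed because every branch of
  H maps the integral curves of the product u F to straight lines with velocity u; when
  u has Euclidean norm 1, the metric obtained by scaling the pullback by the inverse square
  of the norm of e therefore gives u F the constant length 1 / norm e, which is 1 only
  if norm e = 1.\<close>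

definition geodesible :: "metric3 \<Rightarrow> vec3 set \<Rightarrow> (vec3 \<Rightarrow> vec3) \<Rightarrow> bool" where
  "geodesible g S K \<longleftrightarrow> geodesible_with_speed 1 g S K"

section \<open>The family of vector fields\<close>

definition sphere_point :: "real \<Rightarrow> real \<Rightarrow> vec3" where
  "sphere_point \<theta> \<phi> = vector [cos \<theta> * sin \<phi>, sin \<theta> * sin \<phi>, cos \<phi>]"

definition rotated_field :: "product3 \<Rightarrow> (vec3 \<Rightarrow> vec3) \<Rightarrow> real \<Rightarrow> real \<Rightarrow> vec3 \<Rightarrow> vec3" where
  "rotated_field m F \<theta> \<phi> = (\<lambda>w. m (sphere_point \<theta> \<phi>) (F w))"

definition field_family :: "product3 \<Rightarrow> (vec3 \<Rightarrow> vec3) \<Rightarrow> (vec3 \<Rightarrow> vec3) set" where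
  "field_family m F =
     {rotated_field m F \<theta> \<phi> | \<theta> \<phi>. 0 \<le> \<theta> \<and> \<theta> \<le> 2 * pi \<and> 0 \<le> \<phi> \<and> \<phi> \<le> pi}"

definition coordinate_field :: "product3 \<Rightarrow> (vec3 \<Rightarrow> vec3) \<Rightarrow> 3 \<Rightarrow> vec3 \<Rightarrow> vec3" where
  "coordinate_field m F i = (\<lambda>w. m (axis i 1) (F w))"

definition lie_bracket :: "(vec3 \<Rightarrow> vec3) \<Rightarrow> (vec3 \<Rightarrow> vec3) \<Rightarrow> vec3 \<Rightarrow> vec3" where
  "lie_bracket K\<^sub>1 K\<^sub>2 w =
     frechet_derivative K\<^sub>2 (at w) (K\<^sub>1 w) - frechet_derivative K\<^sub>1 (at w) (K\<^sub>2 w)"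

definition commutative_family_on :: "vec3 set \<Rightarrow> (vec3 \<Rightarrow> vec3) set \<Rightarrow> bool" where
  "commutative_family_on S \<F> \<longleftrightarrow> (\<forall>K\<^sub>1\<in>\<F>. \<forall>K\<^sub>2\<in>\<F>. \<forall>w\<in>S. lie_bracket K\<^sub>1 K\<^sub>2 w = 0)"

end

theory Submission
  imports Defs
begin

text \<open>
  Write \<open>G = e / F\<close>. Every branch of \<open>H\<close> is a primitive of the algebra-valued one-form
  \<open>\<xi> \<mapsto> m (G w) \<xi>\<close>, so it carries the field \<open>u F\<close> to the constant field \<open>u\<close> and its integral curves to
  straight lines run with velocity \<open>u\<close>. The metric is the Euclidean metric pulled back along \<open>H\<close> and divided
  by the square of \<open>norm e\<close>; hence these curves are geodesics of speed \<open>norm u / norm e\<close>, and \<open>norm u = 1\<close> on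
  the sphere.

  The work lies in the low regularity. The field \<open>F\<close> is differentiable but its derivative
  may be discontinuous, as it can be for a product of three one-dimensional algebras.

  \<^item> For the pullback to be defined, branches of \<open>H\<close> must exist near every point and have a common derivative. The
    form is closed, since its derivative \<open>m (m (G' w) \<xi>) \<eta>\<close> is symmetric in \<open>\<xi>\<close> and \<open>\<eta>\<close>. The lemma
    \<open>closed_form_has_primitive\<close>, which follows Goursat's proof of Cauchy's theorem, gives a primitive on balls;
    \<open>H_branch_exists\<close> identifies it with a branch, and \<open>H_branch_has_derivative\<close> shows that
    the derivative of any branch at \<open>w\<close> is multiplication by \<open>G w\<close>. Thus the metric has the closed form \<open>g_eq\<close>.

  \<^item> A branch is in general not twice continuously differentiable, so the geodesic equation is not transported along it. The
    Christoffel symbols are computed instead: \<open>christoffel_sum\<close> says that the Christoffel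
    term at \<open>x\<close>, \<open>y\<close> is \<open>- (F' / F) x y\<close>, and along an integral curve of \<open>u F\<close> it cancels the acceleration
    \<open>u F' (u F)\<close>.

  The brackets vanish because \<open>[u F, v F] = v F' u F - u F' v F\<close> and the algebra is commutative.
\<close>

section \<open>Primitives of differentiable closed one-forms\<close>

definition segment_integral ::
  "('a::real_normed_vector \<Rightarrow> 'a \<Rightarrow>\<^sub>L 'b::banach) \<Rightarrow> 'a \<Rightarrow> 'a \<Rightarrow> 'b" where
  "segment_integral \<omega> a b = integral {0..1} (\<lambda>t. blinfun_apply (\<omega> (a + t *\<^sub>R (b - a))) (b - a))"

lemma segment_point_in_convex:
  assumes "convex S" "a \<in> S" "b \<in> S" "0 \<le> t" "t \<le> 1"
  shows "a + t *\<^sub>R (b - a) \<in> S"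
proof -
  have "(1 - t) *\<^sub>R a + t *\<^sub>R b \<in> S"
    using assms by (intro convexD_alt) auto
  then show ?thesis by (simp add: algebra_simps)
qed

lemma continuous_on_segment_integrand:
  assumes "continuous_on S \<omega>" "convex S" "a \<in> S" "b \<in> S"
  shows "continuous_on {0..1} (\<lambda>t. blinfun_apply (\<omega> (a + t *\<^sub>R (b - a))) (b - a))"
proof -
  have "continuous_on {0..1} (\<lambda>t::real. a + t *\<^sub>R (b - a))"
    by (intro continuous_intros)
  then have "continuous_on {0..1} (\<lambda>t. \<omega> (a + t *\<^sub>R (b - a)))"
    using assms by (intro continuous_on_compose2[OF assms(1)]) (auto intro: segment_point_in_convex)
  then show ?thesis by (intro continuous_intros)
qed

lemma has_integral_segment_integral:
  assumes "continuous_on S \<omega>" "convex S" "a \<in> S" "b \<in> S"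
  shows "((\<lambda>t. blinfun_apply (\<omega> (a + t *\<^sub>R (b - a))) (b - a)) has_integral segment_integral \<omega> a b) {0..1}"
  unfolding segment_integral_def
  using continuous_on_segment_integrand[OF assms] integrable_continuous_interval by blast

lemma segment_integral_diff_bound:
  assumes "continuous_on S \<omega>" "continuous_on S \<eta>" "convex S" "a \<in> S" "b \<in> S" "0 \<le> B"
    and B: "\<And>x. x \<in> S \<Longrightarrow> norm (\<omega> x - \<eta> x) \<le> B"
  shows "norm (segment_integral \<omega> a b - segment_integral \<eta> a b) \<le> B * norm (b - a)"
proof -
  have "((\<lambda>t. blinfun_apply (\<omega> (a + t *\<^sub>R (b - a))) (b - a) - blinfun_apply (\<eta> (a + t *\<^sub>R (b - a))) (b - a))
     has_integral segment_integral \<omega> a b - segment_integral \<eta> a b) {0..1}"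
    by (intro has_integral_diff has_integral_segment_integral[where S = S] assms)
  moreover have "norm (blinfun_apply (\<omega> (a + t *\<^sub>R (b - a))) (b - a) - blinfun_apply (\<eta> (a + t *\<^sub>R (b - a))) (b - a))
       \<le> B * norm (b - a)" if "t \<in> {0..1} - {}" for t
  proof -
    let ?p = "a + t *\<^sub>R (b - a)"
    have "?p \<in> S" using that assms by (auto intro: segment_point_in_convex)
    have "norm (blinfun_apply (\<omega> ?p - \<eta> ?p) (b - a)) \<le> norm (\<omega> ?p - \<eta> ?p) * norm (b - a)"
      by (rule norm_blinfun)
    also have "\<dots> \<le> B * norm (b - a)" using B[OF \<open>?p \<in> S\<close>] by (simp add: mult_right_mono)
    finally show ?thesis by (simp add: blinfun.diff_left)
  qed
  ultimately have "norm (segment_integral \<omega> a b - segment_integral \<eta> a b) \<le> B * norm (b - a) * measure lborel {0..1::real}"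
    using assms by (intro has_integral_bound_real[where S = "{}"]) auto
  then show ?thesis by simp
qed

lemma segment_integral_of_derivative:
  assumes "convex S" "a \<in> S" "b \<in> S"
    and P: "\<And>x. x \<in> S \<Longrightarrow> (P has_derivative blinfun_apply (\<omega> x)) (at x within S)"
  shows "segment_integral \<omega> a b = P b - P a"
proof -
  have "((\<lambda>t. P (a + t *\<^sub>R (b - a))) has_vector_derivative blinfun_apply (\<omega> (a + t *\<^sub>R (b - a))) (b - a)) (at t within {0..1})"
    if "t \<in> {0..1}" for t
  proof -
    have "a + s *\<^sub>R (b - a) \<in> S" if "s \<in> {0..1}" for s
      using that assms by (auto intro: segment_point_in_convex)
    then have "(P has_derivative blinfun_apply (\<omega> (a + t *\<^sub>R (b - a))))
        (at (a + t *\<^sub>R (b - a)) within (\<lambda>t. a + t *\<^sub>R (b - a)) ` {0..1})"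
      using that by (intro has_derivative_subset[OF P]) auto
    moreover have "((\<lambda>t. a + t *\<^sub>R (b - a)) has_vector_derivative (b - a)) (at t within {0..1})"
      by (auto intro!: derivative_eq_intros)
    ultimately show ?thesis
      using vector_derivative_diff_chain_within[of "\<lambda>t. a + t *\<^sub>R (b - a)" "b - a" t "{0..1}" P]
      by (simp add: o_def)
  qed
  then have "((\<lambda>t. blinfun_apply (\<omega> (a + t *\<^sub>R (b - a))) (b - a)) has_integral
      P (a + 1 *\<^sub>R (b - a)) - P (a + 0 *\<^sub>R (b - a))) {0..1}"
    by (intro fundamental_theorem_of_calculus) auto
  then show ?thesis by (simp add: segment_integral_def integral_unique)
qed

text \<open>The restriction of a continuous one-form to a line has a primitive \<open>\<Phi>\<close>, whether the form is
  closed or not. Reversal of a segment and its division at the midpoint then become identities between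
  values of \<open>\<Phi>\<close>.\<close>

lemma segment_integral_on_line:
  assumes "continuous_on S \<omega>" "convex S" "a \<in> S" "b \<in> S"
  obtains \<Phi> where "\<And>u v. u \<in> {0..1} \<Longrightarrow> v \<in> {0..1} \<Longrightarrow>
    segment_integral \<omega> (a + u *\<^sub>R (b - a)) (a + v *\<^sub>R (b - a)) = \<Phi> v - \<Phi> u"
proof -
  define f where "f t = blinfun_apply (\<omega> (a + t *\<^sub>R (b - a))) (b - a)" for t
  define \<Phi> where "\<Phi> u = integral {0..u} f" for u
  have cf: "continuous_on {0..1} f"
    unfolding f_def by (rule continuous_on_segment_integrand[OF assms])
  have \<Phi>: "(\<Phi> has_vector_derivative f u) (at u within {0..1})" if "u \<in> {0..1}" for u
    unfolding \<Phi>_def using cf that by (rule integral_has_vector_derivative)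
  show ?thesis
  proof (rule that[of \<Phi>])
    fix u v :: real assume uv: "u \<in> {0..1}" "v \<in> {0..1}"
    have inI: "u + t * (v - u) \<in> {0..1}" if "t \<in> {0..1}" for t
      using segment_point_in_convex[of "{0..1}" u v t] uv that by auto
    have "((\<lambda>t. \<Phi> (u + t * (v - u))) has_vector_derivative (v - u) *\<^sub>R f (u + t * (v - u))) (at t within {0..1})"
      if "t \<in> {0..1}" for t
    proof -
      have "(\<Phi> has_vector_derivative f (u + t * (v - u))) (at (u + t * (v - u)) within (\<lambda>t. u + t * (v - u)) ` {0..1})"
        by (rule has_vector_derivative_within_subset[OF \<Phi>[OF inI[OF that]]]) (use inI in blast)
      moreover have "((\<lambda>t. u + t * (v - u)) has_vector_derivative (v - u)) (at t within {0..1})"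
        unfolding has_vector_derivative_def by (auto intro!: derivative_eq_intros simp: mult.commute)
      ultimately show ?thesis
        using vector_diff_chain_within[of "\<lambda>t. u + t * (v - u)" "v - u" t "{0..1}" \<Phi>]
        by (simp add: o_def)
    qed
    then have "((\<lambda>t. (v - u) *\<^sub>R f (u + t * (v - u))) has_integral \<Phi> (u + 1 * (v - u)) - \<Phi> (u + 0 * (v - u))) {0..1}"
      by (intro fundamental_theorem_of_calculus) auto
    moreover have "blinfun_apply (\<omega> (a + u *\<^sub>R (b - a) + t *\<^sub>R (a + v *\<^sub>R (b - a) - (a + u *\<^sub>R (b - a)))))
        (a + v *\<^sub>R (b - a) - (a + u *\<^sub>R (b - a))) = (v - u) *\<^sub>R f (u + t * (v - u))" for t
    proof -
      have "a + u *\<^sub>R (b - a) + t *\<^sub>R (a + v *\<^sub>R (b - a) - (a + u *\<^sub>R (b - a))) = a + (u + t * (v - u)) *\<^sub>R (b - a)"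
        by (simp add: algebra_simps)
      moreover have "a + v *\<^sub>R (b - a) - (a + u *\<^sub>R (b - a)) = (v - u) *\<^sub>R (b - a)"
        by (simp add: algebra_simps)
      ultimately show ?thesis by (simp only: f_def blinfun.scaleR_right)
    qed
    ultimately show "segment_integral \<omega> (a + u *\<^sub>R (b - a)) (a + v *\<^sub>R (b - a)) = \<Phi> v - \<Phi> u"
      unfolding segment_integral_def by (simp only: integral_unique) simp
  qed
qed

lemma segment_integral_reverse:
  assumes "continuous_on S \<omega>" "convex S" "a \<in> S" "b \<in> S"
  shows "segment_integral \<omega> b a = - segment_integral \<omega> a b"
proof -
  obtain \<Phi> where \<Phi>: "\<And>u v. u \<in> {0..1} \<Longrightarrow> v \<in> {0..1} \<Longrightarrow>
    segment_integral \<omega> (a + u *\<^sub>R (b - a)) (a + v *\<^sub>R (b - a)) = \<Phi> v - \<Phi> u"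
    using segment_integral_on_line[OF assms] by blast
  show ?thesis using \<Phi>[of 0 1] \<Phi>[of 1 0] by simp
qed

lemma segment_integral_midpoint:
  assumes "continuous_on S \<omega>" "convex S" "a \<in> S" "b \<in> S"
  shows "segment_integral \<omega> a b = segment_integral \<omega> a (midpoint a b) + segment_integral \<omega> (midpoint a b) b"
proof -
  obtain \<Phi> where \<Phi>: "\<And>u v. u \<in> {0..1} \<Longrightarrow> v \<in> {0..1} \<Longrightarrow>
    segment_integral \<omega> (a + u *\<^sub>R (b - a)) (a + v *\<^sub>R (b - a)) = \<Phi> v - \<Phi> u"
    using segment_integral_on_line[OF assms] by blast
  have mid: "a + (1 / 2) *\<^sub>R (b - a) = midpoint a b"
    by (simp add: midpoint_def field_simps) (simp add: scaleR_2 flip: scaleR_add_left)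
  have "segment_integral \<omega> a (midpoint a b) = \<Phi> (1/2) - \<Phi> 0"
    "segment_integral \<omega> (midpoint a b) b = \<Phi> 1 - \<Phi> (1/2)"
    using \<Phi>[of 0 "1/2"] \<Phi>[of "1/2" 1] by (simp_all add: mid)
  then show ?thesis using \<Phi>[of 0 1] by simp
qed

definition triangle_integral ::
  "('a::real_normed_vector \<Rightarrow> 'a \<Rightarrow>\<^sub>L 'b::banach) \<Rightarrow> 'a \<Rightarrow> 'a \<Rightarrow> 'a \<Rightarrow> 'b" where
  "triangle_integral \<omega> a b c = segment_integral \<omega> a b + segment_integral \<omega> b c + segment_integral \<omega> c a"

text \<open>The midpoints of the sides cut the triangle into four of half the diameter. The inner sides
  cancel in pairs, so one of the four parts carries at least a quarter of the integral. The constant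
  \<open>E\<close>, a lower bound for the integral per squared diameter, is therefore inherited by that part,
  and the step can be iterated.\<close>

lemma triangle_integral_quadrisection:
  assumes cont: "continuous_on S \<omega>" and S: "convex S" and abc: "a \<in> S" "b \<in> S" "c \<in> S"
    and K: "dist a b \<le> K" "dist b c \<le> K" "dist c a \<le> K"
    and E: "E * K\<^sup>2 \<le> norm (triangle_integral \<omega> a b c)"
  shows "\<exists>a' b' c'. a' \<in> S \<and> b' \<in> S \<and> c' \<in> S \<and> dist a a' \<le> K \<and>
    dist a' b' \<le> K / 2 \<and> dist b' c' \<le> K / 2 \<and> dist c' a' \<le> K / 2 \<and>
    E * (K / 2)\<^sup>2 \<le> norm (triangle_integral \<omega> a' b' c')"
proof -
  define p where "p = midpoint b c"
  define q where "q = midpoint c a"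
  define r where "r = midpoint a b"
  have mids: "p \<in> S" "q \<in> S" "r \<in> S"
    using S abc by (auto simp: p_def q_def r_def convex_contains_segment dest: subsetD[OF _ midpoint_in_closed_segment])
  note rev = segment_integral_reverse[OF cont S]
  have split: "segment_integral \<omega> b c = segment_integral \<omega> b p + segment_integral \<omega> p c"
    "segment_integral \<omega> c a = segment_integral \<omega> c q + segment_integral \<omega> q a"
    "segment_integral \<omega> a b = segment_integral \<omega> a r + segment_integral \<omega> r b"
    unfolding p_def q_def r_def by (rule segment_integral_midpoint[OF cont S]; fact)+
  have "triangle_integral \<omega> a b c = triangle_integral \<omega> a r q + triangle_integral \<omega> r b p
      + triangle_integral \<omega> q p c + triangle_integral \<omega> p q r"
    unfolding triangle_integral_def split
    using rev[of p q] rev[of q r] rev[of r p] mids by simp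
  then have "norm (triangle_integral \<omega> a b c) \<le> norm (triangle_integral \<omega> a r q) + norm (triangle_integral \<omega> r b p)
      + norm (triangle_integral \<omega> q p c) + norm (triangle_integral \<omega> p q r)"
    by (metis (no_types) norm_triangle_ineq norm_triangle_le add_mono_thms_linordered_semiring(3))
  moreover have "E * K\<^sup>2 = 4 * (E * (K / 2)\<^sup>2)" by (simp add: power2_eq_square)
  ultimately consider "E * (K / 2)\<^sup>2 \<le> norm (triangle_integral \<omega> a r q)"
    | "E * (K / 2)\<^sup>2 \<le> norm (triangle_integral \<omega> r b p)"
    | "E * (K / 2)\<^sup>2 \<le> norm (triangle_integral \<omega> q p c)"
    | "E * (K / 2)\<^sup>2 \<le> norm (triangle_integral \<omega> p q r)"
    using E by linarith
  moreover have half: "dist (midpoint x y) (midpoint x z) = dist y z / 2"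
    "dist (midpoint x y) (midpoint z x) = dist y z / 2"
    "dist (midpoint y x) (midpoint x z) = dist y z / 2"
    "dist (midpoint y x) (midpoint z x) = dist y z / 2" for x y z :: 'a
    by (simp_all add: midpoint_def dist_norm flip: scaleR_diff_right)
  have "dist p q \<le> K / 2" "dist q r \<le> K / 2" "dist r p \<le> K / 2"
    using K unfolding p_def q_def r_def half by (simp_all add: dist_commute)
  moreover have "dist a r \<le> K / 2" "dist r b \<le> K / 2" "dist b p \<le> K / 2" "dist p c \<le> K / 2"
    "dist c q \<le> K / 2" "dist q a \<le> K / 2"
    using K by (simp_all add: p_def q_def r_def dist_midpoint dist_commute)
  moreover have "dist a p \<le> K"
    using dist_triangle[of a p r] calculation by (simp add: dist_commute)
  moreover have "dist a a \<le> K" "dist a q \<le> K" "dist a r \<le> K"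
    using K calculation zero_le_dist[of a b] zero_le_dist[of a q] zero_le_dist[of a r]
    by (simp_all add: dist_commute del: zero_le_dist)
  ultimately show ?thesis
    using mids abc by (metis dist_commute)
qed

text \<open>Symmetry of \<open>D\<close> is what makes the two halves of the derivative of the quadratic term agree.\<close>

lemma symmetric_affine_form_has_primitive:
  fixes A :: "'a::real_normed_vector \<Rightarrow>\<^sub>L 'b::banach" and D :: "'a \<Rightarrow> 'a \<Rightarrow>\<^sub>L 'b"
  assumes "bounded_linear D"
    and sym: "\<And>\<xi> \<eta>. blinfun_apply (D \<xi>) \<eta> = blinfun_apply (D \<eta>) \<xi>"
  shows "((\<lambda>y. blinfun_apply A y + (1 / 2) *\<^sub>R blinfun_apply (D (y - x)) (y - x)) has_derivative
     blinfun_apply (A + D (y - x))) (at y within S)"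
proof -
  have D: "((\<lambda>y. D (y - x)) has_derivative D) (at y within S)"
    by (rule bounded_linear.has_derivative[OF assms(1)]) (auto intro!: derivative_eq_intros)
  show ?thesis
    by (rule derivative_eq_intros refl D blinfun.FDERIV)+
       (auto simp: fun_eq_iff blinfun.add_left sym[of _ "y - x"] simp flip: scaleR_add_left intro: scaleR_half_double)
qed

text \<open>Goursat's argument. If the integral were not zero, quadrisection would give triangles shrinking
  to a point \<open>x\<close> whose integrals are at least \<open>E\<close> times the squared diameter. Near \<open>x\<close> the form
  differs from its affine approximation by an error that is small compared with the distance to \<open>x\<close>,
  and the affine form integrates to zero around every triangle. So the integrals are small compared
  with the squared diameter, a contradiction. The derivative of the
  form may be discontinuous, so Stokes' theorem would not apply.\<close>

lemma triangle_integral_eq_0: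
  fixes \<omega> :: "'a::real_normed_vector \<Rightarrow> 'a \<Rightarrow>\<^sub>L 'b::banach"
  assumes S: "convex S" and abc: "a \<in> S" "b \<in> S" "c \<in> S"
    and deriv: "\<And>x. x \<in> S \<Longrightarrow> (\<omega> has_derivative D x) (at x within S)"
    and sym: "\<And>x \<xi> \<eta>. x \<in> S \<Longrightarrow> blinfun_apply (D x \<xi>) \<eta> = blinfun_apply (D x \<eta>) \<xi>"
  shows "triangle_integral \<omega> a b c = 0"
proof (rule ccontr)
  assume nz: "triangle_integral \<omega> a b c \<noteq> 0"
  define T where "T = convex hull {a, b, c}"
  have T: "convex T" "compact T" "T \<subseteq> S" "a \<in> T" "b \<in> T" "c \<in> T"
    using S abc by (auto simp: T_def hull_inc subset_hull intro: finite_imp_compact_convex_hull)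
  have cont: "continuous_on S \<omega>"
    using deriv has_derivative_continuous_on by blast
  then have contT: "continuous_on T \<omega>" using T continuous_on_subset by blast
  define d where "d = dist a b + dist b c + dist c a"
  have "d > 0"
  proof (rule ccontr)
    assume "\<not> d > 0"
    then have "a = b" "b = c" using zero_le_dist[of a b] zero_le_dist[of b c] zero_le_dist[of c a]
      unfolding d_def by (smt (verit) dist_eq_0_iff)+
    then have "triangle_integral \<omega> a b c = 0" by (simp add: triangle_integral_def segment_integral_def)
    with nz show False by simp
  qed
  define E where "E = norm (triangle_integral \<omega> a b c) / d\<^sup>2"
  have "E > 0" using nz \<open>d > 0\<close> by (simp add: E_def)
  define P where "P n = (\<lambda>(x, y, z). x \<in> T \<and> y \<in> T \<and> z \<in> T \<and>
    dist x y \<le> d / 2 ^ n \<and> dist y z \<le> d / 2 ^ n \<and> dist z x \<le> d / 2 ^ n \<and>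
    E * (d / 2 ^ n)\<^sup>2 \<le> norm (triangle_integral \<omega> x y z))" for n :: nat
  have "\<exists>t. \<forall>n. P n (t n) \<and> dist (fst (t n)) (fst (t (Suc n))) \<le> d / 2 ^ n"
  proof (rule dependent_nat_choice)
    have "P 0 (a, b, c)"
      using T \<open>d > 0\<close> by (simp add: P_def E_def) (simp add: d_def)
    then show "\<exists>t. P 0 t" ..
  next
    fix s n assume "P n s"
    then obtain x y z where s: "s = (x, y, z)" "x \<in> T" "y \<in> T" "z \<in> T"
      "dist x y \<le> d / 2 ^ n" "dist y z \<le> d / 2 ^ n" "dist z x \<le> d / 2 ^ n"
      "E * (d / 2 ^ n)\<^sup>2 \<le> norm (triangle_integral \<omega> x y z)"
      unfolding P_def by auto
    obtain x' y' z' where "x' \<in> T" "y' \<in> T" "z' \<in> T" "dist x x' \<le> d / 2 ^ n"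
      "dist x' y' \<le> d / 2 ^ n / 2" "dist y' z' \<le> d / 2 ^ n / 2" "dist z' x' \<le> d / 2 ^ n / 2"
      "E * (d / 2 ^ n / 2)\<^sup>2 \<le> norm (triangle_integral \<omega> x' y' z')"
      using triangle_integral_quadrisection[OF contT T(1) s(2-8)] by blast
    then show "\<exists>t. P (Suc n) t \<and> dist (fst s) (fst t) \<le> d / 2 ^ n"
      by (intro exI[of _ "(x', y', z')"]) (simp add: P_def s(1) field_simps)
  qed
  then obtain t where Pt: "\<And>n. P n (t n)" and step: "\<And>n. dist (fst (t n)) (fst (t (Suc n))) \<le> d / 2 ^ n"
    by blast
  define u where "u n = fst (t n)" for n
  \<comment> \<open>The first corners move by at most \<open>d / 2 ^ n\<close> in step \<open>n\<close>; the geometric series is summed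
    exactly, so that the induction closes.\<close>
  have far: "dist (u n) (u (n + k)) \<le> 2 * d / 2 ^ n - 2 * d / 2 ^ (n + k)" for n k
  proof (induction k)
    case (Suc k)
    have "dist (u n) (u (n + Suc k)) \<le> dist (u n) (u (n + k)) + dist (u (n + k)) (u (Suc (n + k)))"
      using dist_triangle by simp
    also have "\<dots> \<le> (2 * d / 2 ^ n - 2 * d / 2 ^ (n + k)) + d / 2 ^ (n + k)"
      using Suc step[of "n + k"] by (simp add: u_def)
    also have "\<dots> = 2 * d / 2 ^ n - 2 * d / 2 ^ (n + Suc k)" by simp
    finally show ?case .
  qed simp
  have uT: "u n \<in> T" for n using Pt[of n] by (auto simp: u_def P_def split: prod.splits)
  obtain x r where x: "x \<in> T" and r: "strict_mono r" and lim: "(u \<circ> r) \<longlonglongrightarrow> x"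
    using \<open>compact T\<close> uT unfolding compact_def by blast
  have near: "dist (u n) x \<le> 2 * d / 2 ^ n" for n
  proof (rule Lim_bounded)
    show "(\<lambda>k. dist (u n) ((u \<circ> r) k)) \<longlonglongrightarrow> dist (u n) x"
      using lim by (intro tendsto_intros)
    show "\<forall>k\<ge>n. dist (u n) ((u \<circ> r) k) \<le> 2 * d / 2 ^ n"
    proof (intro allI impI)
      fix k assume "n \<le> k"
      then have "n \<le> r k" using r seq_suble order_trans by blast
      then obtain j where "r k = n + j" using le_Suc_ex by blast
      then show "dist (u n) ((u \<circ> r) k) \<le> 2 * d / 2 ^ n"
        using far[of n j] \<open>d > 0\<close> by (simp add: order_trans)
    qed
  qed
  have "x \<in> S" using x T by blast
  have bl: "bounded_linear (D x)" using deriv[OF \<open>x \<in> S\<close>] by (rule has_derivative_bounded_linear)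
  \<comment> \<open>All points of the \<open>n\<close>-th triangle are within three of its diameters of \<open>x\<close>, and there are three
    sides: the error is at most \<open>9 * (E / 18) = E / 2\<close> times the squared diameter.\<close>
  obtain \<delta> where "\<delta> > 0" and \<delta>: "\<And>y. y \<in> S \<Longrightarrow> norm (y - x) < \<delta> \<Longrightarrow>
      norm (\<omega> y - \<omega> x - D x (y - x)) \<le> E / 18 * norm (y - x)"
    using deriv[OF \<open>x \<in> S\<close>] \<open>E > 0\<close> unfolding has_derivative_within_alt
    by (metis zero_less_divide_iff zero_less_numeral)
  obtain n where n: "(1 / 2) ^ n < \<delta> / (4 * d)"
    using real_arch_pow_inv[of "\<delta> / (4 * d)" "1 / 2"] \<open>\<delta> > 0\<close> \<open>d > 0\<close> by auto
  define \<rho> where "\<rho> = d / 2 ^ n"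
  have "\<rho> > 0" "4 * \<rho> < \<delta>" using n \<open>d > 0\<close> by (simp_all add: \<rho>_def field_simps power_one_over)
  obtain p q s where t: "t n = (p, q, s)" by (metis prod_cases3)
  have pqs: "p \<in> T" "q \<in> T" "s \<in> T" "dist p q \<le> \<rho>" "dist q s \<le> \<rho>" "dist s p \<le> \<rho>"
    and big: "E * \<rho>\<^sup>2 \<le> norm (triangle_integral \<omega> p q s)"
    using Pt[of n] unfolding t P_def \<rho>_def by auto
  define V where "V = S \<inter> cball x (3 * \<rho>)"
  have "dist p x \<le> 2 * \<rho>" using near[of n] by (simp add: u_def t \<rho>_def)
  then have inV: "p \<in> V" "q \<in> V" "s \<in> V"
    using pqs T \<open>\<rho> > 0\<close> dist_triangle[of q x p] dist_triangle[of s x p] by (auto simp: V_def dist_commute)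
  have V: "convex V" using S by (simp add: V_def convex_Int)
  \<comment> \<open>the affine approximation of \<open>\<omega>\<close> at \<open>x\<close>, with the constant part separated\<close>
  define \<eta> where "\<eta> y = (\<omega> x - D x x) + D x y" for y
  have \<eta>: "\<eta> y = \<omega> x + D x (y - x)" for y
    by (simp add: \<eta>_def linear_diff[OF bounded_linear.linear[OF bl]])
  have contV: "continuous_on V \<omega>" "continuous_on V \<eta>"
    using continuous_on_subset[OF cont] unfolding V_def \<eta>_def
    by (auto intro!: continuous_on_add continuous_on_const linear_continuous_on[OF bl])
  have bound: "norm (segment_integral \<omega> y z - segment_integral \<eta> y z) \<le> E / 18 * (3 * \<rho>) * \<rho>"
    if "y \<in> V" "z \<in> V" "dist y z \<le> \<rho>" for y z
  proof -
    have "norm (\<omega> v - \<eta> v) \<le> E / 18 * (3 * \<rho>)" if "v \<in> V" for v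
    proof -
      have v: "v \<in> S" "norm (v - x) \<le> 3 * \<rho>" using that by (auto simp: V_def dist_norm norm_minus_commute)
      then have "norm (\<omega> v - \<omega> x - D x (v - x)) \<le> E / 18 * norm (v - x)"
        using \<open>4 * \<rho> < \<delta>\<close> \<open>\<rho> > 0\<close> by (intro \<delta>) auto
      also have "\<dots> \<le> E / 18 * (3 * \<rho>)" using v \<open>E > 0\<close> by (intro mult_left_mono) auto
      finally show ?thesis by (simp add: \<eta> diff_diff_add)
    qed
    then have "norm (segment_integral \<omega> y z - segment_integral \<eta> y z) \<le> E / 18 * (3 * \<rho>) * norm (z - y)"
      using \<open>E > 0\<close> \<open>\<rho> > 0\<close> that by (intro segment_integral_diff_bound[OF contV V]) auto
    also have "\<dots> \<le> E / 18 * (3 * \<rho>) * \<rho>"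
      using that \<open>E > 0\<close> \<open>\<rho> > 0\<close> by (intro mult_left_mono) (auto simp: dist_norm norm_minus_commute)
    finally show ?thesis .
  qed
  have "triangle_integral \<eta> p q s = 0"
  proof -
    define Q where "Q y = blinfun_apply (\<omega> x) y + (1 / 2) *\<^sub>R blinfun_apply (D x (y - x)) (y - x)" for y
    have "(Q has_derivative blinfun_apply (\<eta> y)) (at y within V)" for y
      unfolding Q_def \<eta> using symmetric_affine_form_has_primitive[OF bl sym[OF \<open>x \<in> S\<close>]] .
    then have "segment_integral \<eta> y z = Q z - Q y" if "y \<in> V" "z \<in> V" for y z
      using that V by (intro segment_integral_of_derivative) auto
    then show ?thesis using inV by (simp add: triangle_integral_def)
  qed
  then have "triangle_integral \<omega> p q s = (segment_integral \<omega> p q - segment_integral \<eta> p q)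
      + (segment_integral \<omega> q s - segment_integral \<eta> q s) + (segment_integral \<omega> s p - segment_integral \<eta> s p)"
    by (simp add: triangle_integral_def algebra_simps)
  then have "norm (triangle_integral \<omega> p q s) \<le> norm (segment_integral \<omega> p q - segment_integral \<eta> p q)
      + norm (segment_integral \<omega> q s - segment_integral \<eta> q s) + norm (segment_integral \<omega> s p - segment_integral \<eta> s p)"
    by (metis norm_triangle_ineq norm_triangle_le add_right_mono)
  also have "\<dots> \<le> 3 * (E / 18 * (3 * \<rho>) * \<rho>)"
    using bound[of p q] bound[of q s] bound[of s p] inV pqs by simp
  also have "\<dots> = E * \<rho>\<^sup>2 / 2" by (simp add: power2_eq_square)
  also have "\<dots> < E * \<rho>\<^sup>2" using \<open>E > 0\<close> \<open>\<rho> > 0\<close> by simp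
  finally show False using big by simp
qed

text \<open>The form is nearly constant on short segments, and the integral of a constant form over a
  segment is its value at the difference of the end points. This serves twice: to construct a
  primitive, and to differentiate a function known only through its line integrals.\<close>

lemma has_derivative_of_segment_integrals:
  assumes cont: "continuous_on S \<omega>" and S: "convex S" and x: "x \<in> S"
    and h: "\<And>y. y \<in> S \<Longrightarrow> h y - h x = segment_integral \<omega> x y"
  shows "(h has_derivative blinfun_apply (\<omega> x)) (at x within S)"
  unfolding has_derivative_within_alt
proof (intro conjI allI impI)
  show "bounded_linear (blinfun_apply (\<omega> x))" by (rule blinfun.bounded_linear_right)
  fix \<epsilon> :: real assume "\<epsilon> > 0"
  then obtain \<delta> where "\<delta> > 0" and \<delta>: "\<And>y. y \<in> S \<Longrightarrow> dist y x < \<delta> \<Longrightarrow> dist (\<omega> y) (\<omega> x) < \<epsilon>"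
    using cont x unfolding continuous_on_iff by metis
  have "norm (h y - h x - blinfun_apply (\<omega> x) (y - x)) \<le> \<epsilon> * norm (y - x)" if y: "y \<in> S" "norm (y - x) < \<delta>" for y
  proof -
    define V where "V = S \<inter> ball x \<delta>"
    have V: "convex V" "x \<in> V" "y \<in> V" "continuous_on V \<omega>"
      using S x y \<open>\<delta> > 0\<close> continuous_on_subset[OF cont]
      by (auto simp: V_def convex_Int dist_norm norm_minus_commute)
    have "segment_integral (\<lambda>_. \<omega> x) x y = blinfun_apply (\<omega> x) (y - x)"
      by (simp add: segment_integral_def)
    moreover have "norm (segment_integral \<omega> x y - segment_integral (\<lambda>_. \<omega> x) x y) \<le> \<epsilon> * norm (y - x)"
    proof (rule segment_integral_diff_bound[of V])
      show "norm (\<omega> z - \<omega> x) \<le> \<epsilon>" if "z \<in> V" for z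
        using \<delta>[of z] that by (auto simp: V_def dist_norm norm_minus_commute)
    qed (use V \<open>\<epsilon> > 0\<close> in auto)
    ultimately show ?thesis using h[OF y(1)] by simp
  qed
  then show "\<exists>\<delta>>0. \<forall>y\<in>S. norm (y - x) < \<delta> \<longrightarrow> norm (h y - h x - blinfun_apply (\<omega> x) (y - x)) \<le> \<epsilon> * norm (y - x)"
    using \<open>\<delta> > 0\<close> by blast
qed

text \<open>The Poincare lemma for one-forms that are merely differentiable. Symmetry of the derivative
  is closedness.\<close>

lemma closed_form_has_primitive:
  fixes \<omega> :: "'a::real_normed_vector \<Rightarrow> 'a \<Rightarrow>\<^sub>L 'b::banach"
  assumes S: "convex S"
    and deriv: "\<And>x. x \<in> S \<Longrightarrow> (\<omega> has_derivative D x) (at x within S)"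
    and sym: "\<And>x \<xi> \<eta>. x \<in> S \<Longrightarrow> blinfun_apply (D x \<xi>) \<eta> = blinfun_apply (D x \<eta>) \<xi>"
  obtains h where "\<And>x. x \<in> S \<Longrightarrow> (h has_derivative blinfun_apply (\<omega> x)) (at x within S)"
proof (cases "S = {}")
  case False
  then obtain a where a: "a \<in> S" by blast
  have cont: "continuous_on S \<omega>"
    using deriv has_derivative_continuous_on by blast
  have "segment_integral \<omega> a y - segment_integral \<omega> a x = segment_integral \<omega> x y"
    if "x \<in> S" "y \<in> S" for x y
    using triangle_integral_eq_0[OF S a that deriv sym] segment_integral_reverse[OF cont S a that(2)]
    by (simp add: triangle_integral_def algebra_simps)
  then show ?thesis
    using has_derivative_of_segment_integrals[OF cont S] that[of "segment_integral \<omega> a"] by blast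
qed (use that in auto)

section \<open>Inversion in a commutative algebra\<close>

locale fin_dim_algebra =
  fixes m :: product3 and e :: vec3
  assumes algebra: "algebra3 m e"
begin

abbreviation reciprocal :: "vec3 \<Rightarrow> vec3" where "reciprocal \<equiv> alg_inverse m e"

sublocale prod: bounded_bilinear m
  using algebra by (simp add: algebra3_def bilinear_conv_bounded_bilinear)

lemma assoc: "m (m x y) z = m x (m y z)"
  and commute: "m x y = m y x"
  and unit [simp]: "m e x = x" "m x e = x"
  using algebra unfolding algebra3_def by metis+

lemma left_commute: "m x (m y z) = m y (m x z)"
  by (metis assoc commute)

lemmas ac = assoc commute left_commute

lemma unit_nonzero: "e \<noteq> 0"
proof
  assume "e = 0"
  then have "axis 1 1 = (0 :: vec3)" using unit(1)[of "axis 1 1"] prod.zero_left by metis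
  then show False by (simp add: axis_eq_0_iff)
qed

lemma reciprocal_eqI: "m a b = e \<Longrightarrow> reciprocal a = b"
  unfolding alg_inverse_def by (rule the_equality) (auto, metis assoc commute unit(1))

lemma mult_reciprocal: "regular m e a \<Longrightarrow> m a (reciprocal a) = e"
  using reciprocal_eqI by (auto simp: regular_def)

lemma reciprocal_mult: "regular m e a \<Longrightarrow> m (reciprocal a) a = e"
  using mult_reciprocal commute by metis

lemma cancel_regular: "regular m e a \<Longrightarrow> m a (m (reciprocal a) x) = x" "regular m e a \<Longrightarrow> m (reciprocal a) (m a x) = x"
  by (metis assoc mult_reciprocal reciprocal_mult unit(1))+

lemma linear_mult: "linear (m a)"
  using prod.bounded_linear_right bounded_linear.linear by blast

text \<open>If \<open>a\<close> is regular with inverse \<open>b\<close> and \<open>m c x = 0\<close>, then \<open>x = m b (m (a - c) x)\<close>. For \<open>c\<close> close to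
  \<open>a\<close> the right-hand side is shorter than \<open>x\<close> unless \<open>x = 0\<close>. So multiplication by \<open>c\<close> is injective,
  hence surjective because the dimension is finite, and \<open>c\<close> is regular.\<close>

lemma open_regular: "open {a. regular m e a}"
  unfolding open_dist
proof (intro ballI)
  fix a assume "a \<in> {a. regular m e a}"
  then have a: "regular m e a" by simp
  define b where "b = reciprocal a"
  obtain K where "K > 0" and K: "\<And>x y. norm (m x y) \<le> norm x * norm y * K"
    using prod.pos_bounded by blast
  define \<delta> where "\<delta> = 1 / (K * K * (norm b + 1))"
  have "\<delta> > 0" using \<open>K > 0\<close> by (simp add: \<delta>_def add_nonneg_pos)
  have "regular m e c" if c: "dist c a < \<delta>" for c
  proof -
    have "x = 0" if "m c x = 0" for x
    proof (rule ccontr)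
      assume "x \<noteq> 0"
      have "x = m b (m a x)" using cancel_regular a by (simp add: b_def)
      also have "\<dots> = m b (m (a - c) x)" using that by (simp add: prod.diff_left)
      finally have "norm x \<le> norm b * norm (m (a - c) x) * K" using K by metis
      also have "\<dots> \<le> norm b * (norm (a - c) * norm x * K) * K"
        using K[of "a - c" x] \<open>K > 0\<close> by (intro mult_right_mono mult_left_mono) auto
      finally have "1 * norm x \<le> (norm (a - c) * (K * K * norm b)) * norm x" by (simp add: mult_ac)
      then have "1 \<le> norm (a - c) * (K * K * norm b)" using \<open>x \<noteq> 0\<close> by simp
      also have "\<dots> \<le> norm (a - c) * (K * K * (norm b + 1))"
        using \<open>K > 0\<close> by (intro mult_left_mono) auto
      also have "\<dots> < \<delta> * (K * K * (norm b + 1))"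
        using c \<open>K > 0\<close> by (intro mult_strict_right_mono) (auto simp: dist_norm norm_minus_commute add_nonneg_pos)
      also have "\<dots> = 1" using \<open>\<delta> > 0\<close> unfolding \<delta>_def by (metis nonzero_eq_divide_eq zero_less_divide_1_iff less_irrefl)
      finally show False by simp
    qed
    then have "inj (m c)" using linear_mult linear_injective_0 by blast
    then have "surj (m c)" using linear_mult linear_injective_imp_surjective by blast
    then show ?thesis unfolding regular_def by (metis surjE)
  qed
  then show "\<exists>\<delta>>0. \<forall>c. dist c a < \<delta> \<longrightarrow> c \<in> {a. regular m e a}"
    using \<open>\<delta> > 0\<close> by blast
qed

lemma reciprocal_diff: "regular m e a \<Longrightarrow> regular m e c \<Longrightarrow> reciprocal c - reciprocal a = m (reciprocal c) (m (reciprocal a) (a - c))"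
  by (simp add: prod.diff_right) (metis cancel_regular(2) commute left_commute mult_reciprocal unit(2))

text \<open>The identity \<open>1/c - 1/a = (1/c) (1/a) (a - c)\<close> bounds the inverse near \<open>a\<close>. Using it twice turns
  the error of the linear approximation into \<open>(1/c) (1/a)\<^sup>2 (a - c)\<^sup>2\<close>, which is of second order.\<close>

lemma has_derivative_reciprocal:
  assumes a: "regular m e a"
  shows "(reciprocal has_derivative (\<lambda>\<xi>. - m (m (reciprocal a) (reciprocal a)) \<xi>)) (at a)"
proof -
  define b where "b = reciprocal a"
  obtain K where "K > 0" and K: "\<And>x y. norm (m x y) \<le> norm x * norm y * K"
    using prod.pos_bounded by blast
  define M where "M = norm b * K * K"
  have "M \<ge> 0" using \<open>K > 0\<close> by (simp add: M_def)
  obtain \<rho> where "\<rho> > 0" and \<rho>: "\<And>c. dist c a < \<rho> \<Longrightarrow> regular m e c"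
    using open_regular a unfolding open_dist by auto
  have K3: "norm (m x (m b y)) \<le> norm x * norm y * M" for x y
  proof -
    have "norm (m x (m b y)) \<le> norm x * norm (m b y) * K" by (rule K)
    also have "\<dots> \<le> norm x * (norm b * norm y * K) * K"
      using K[of b y] \<open>K > 0\<close> by (intro mult_right_mono mult_left_mono) auto
    finally show ?thesis by (simp add: M_def mult_ac)
  qed
  define \<sigma> where "\<sigma> = min \<rho> (1 / (2 * (M + 1)))"
  have "\<sigma> > 0" using \<open>\<rho> > 0\<close> \<open>M \<ge> 0\<close> by (simp add: \<sigma>_def)
  \<comment> \<open>The radius \<open>\<sigma>\<close> makes the factor \<open>norm (c - a) * M\<close> at most one half, so the term with
    \<open>norm (reciprocal c)\<close> on the right can be absorbed.\<close>
  have small: "norm (reciprocal c) \<le> 2 * norm b" "norm (reciprocal c - b) \<le> 2 * norm b * M * norm (c - a)"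
    if c: "norm (c - a) < \<sigma>" for c
  proof -
    have rc: "regular m e c" using \<rho> c by (simp add: \<sigma>_def dist_norm)
    have d: "norm (reciprocal c - b) \<le> norm (reciprocal c) * norm (c - a) * M"
      using reciprocal_diff[OF a rc] K3[of "reciprocal c" "a - c"] by (simp add: b_def norm_minus_commute)
    have "norm (c - a) * M \<le> 1 / (2 * (M + 1)) * (M + 1)"
      using c \<open>M \<ge> 0\<close> by (intro mult_mono) (auto simp: \<sigma>_def)
    also have "\<dots> = 1 / 2" using \<open>M \<ge> 0\<close> by (simp add: field_simps)
    finally have "norm (reciprocal c) * (norm (c - a) * M) \<le> norm (reciprocal c) * (1 / 2)"
      by (intro mult_left_mono) auto
    then have "norm (reciprocal c) \<le> norm b + norm (reciprocal c) / 2"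
      using d norm_triangle_sub[of "reciprocal c" b] by (simp add: mult.assoc)
    then show *: "norm (reciprocal c) \<le> 2 * norm b" by simp
    have "norm (reciprocal c) * norm (c - a) * M \<le> 2 * norm b * norm (c - a) * M"
      using * \<open>M \<ge> 0\<close> by (intro mult_right_mono) auto
    then show "norm (reciprocal c - b) \<le> 2 * norm b * M * norm (c - a)" using d by (simp add: mult_ac)
  qed
  have key: "norm (reciprocal c - reciprocal a - - m (m (reciprocal a) (reciprocal a)) (c - a)) \<le> (2 * norm b * M * M) * norm (c - a) * norm (c - a)"
    if c: "norm (c - a) < \<sigma>" for c
  proof -
    have rc: "regular m e c" using \<rho> c by (simp add: \<sigma>_def dist_norm)
    define y where "y = m b (a - c)"
    have "m (m b b) (c - a) = - m b y"
      using prod.minus_right[of b "m b (c - a)"] prod.minus_right[of b "c - a"] by (simp add: assoc y_def)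
    moreover have "reciprocal c - b = m (reciprocal c) y"
      using reciprocal_diff[OF a rc] by (simp add: b_def y_def)
    ultimately have "reciprocal c - reciprocal a - - m (m (reciprocal a) (reciprocal a)) (c - a) = m (reciprocal c) y - m b y"
      by (simp add: b_def)
    also have "\<dots> = m (reciprocal c - b) y"
      by (simp add: prod.diff_left)
    finally have "reciprocal c - reciprocal a - - m (m (reciprocal a) (reciprocal a)) (c - a) = m (reciprocal c - b) (m b (a - c))"
      by (simp only: y_def)
    then have "norm (reciprocal c - reciprocal a - - m (m (reciprocal a) (reciprocal a)) (c - a)) \<le> norm (reciprocal c - b) * norm (c - a) * M"
      using K3[of "reciprocal c - b" "a - c"] by (simp add: norm_minus_commute)
    also have "\<dots> \<le> (2 * norm b * M * norm (c - a)) * norm (c - a) * M"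
      using small(2)[OF c] \<open>M \<ge> 0\<close> by (intro mult_right_mono) auto
    finally show ?thesis by (simp add: mult_ac)
  qed
  define L where "L = 2 * norm b * M * M"
  have "L \<ge> 0" using \<open>M \<ge> 0\<close> by (simp add: L_def)
  show ?thesis unfolding has_derivative_within_alt
  proof (intro conjI allI impI)
    show "bounded_linear (\<lambda>\<xi>. - m (m (reciprocal a) (reciprocal a)) \<xi>)"
      by (intro bounded_linear_minus prod.bounded_linear_right)
    fix \<epsilon> :: real assume "\<epsilon> > 0"
    show "\<exists>\<delta>>0. \<forall>c\<in>UNIV. norm (c - a) < \<delta> \<longrightarrow>
       norm (reciprocal c - reciprocal a - - m (m (reciprocal a) (reciprocal a)) (c - a)) \<le> \<epsilon> * norm (c - a)"
    proof (intro exI[of _ "min \<sigma> (\<epsilon> / (L + 1))"] conjI ballI impI)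
      show "min \<sigma> (\<epsilon> / (L + 1)) > 0" using \<open>\<sigma> > 0\<close> \<open>\<epsilon> > 0\<close> \<open>L \<ge> 0\<close> by simp
      fix c assume c: "norm (c - a) < min \<sigma> (\<epsilon> / (L + 1))"
      have "L * norm (c - a) \<le> (L + 1) * (\<epsilon> / (L + 1))"
        using c \<open>L \<ge> 0\<close> by (intro mult_mono) auto
      also have "\<dots> = \<epsilon>" using \<open>L \<ge> 0\<close> by simp
      finally have "L * norm (c - a) * norm (c - a) \<le> \<epsilon> * norm (c - a)" by (intro mult_right_mono) auto
      then show "norm (reciprocal c - reciprocal a - - m (m (reciprocal a) (reciprocal a)) (c - a)) \<le> \<epsilon> * norm (c - a)"
        using key[of c] c by (simp add: L_def)
    qed
  qed
qed

end

section \<open>Branches of the multivalued primitive\<close>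

text \<open>The derivative of the polynomial \<open>3 t\<^sup>2 - 2 t\<^sup>3\<close> vanishes at both ends of the unit interval. Curves run with this
  parameter stop at their ends and can be joined to a curve that is differentiable at the joint.\<close>

definition smooth_step :: "real \<Rightarrow> real" where "smooth_step t = 3 * t\<^sup>2 - 2 * t ^ 3"

lemma smooth_step_ends [simp]: "smooth_step 0 = 0" "smooth_step 1 = 1"
  by (simp_all add: smooth_step_def)

lemma smooth_step_in_unit: "t \<in> {0..1} \<Longrightarrow> smooth_step t \<in> {0..1}"
proof -
  assume t: "t \<in> {0..1}"
  have "smooth_step t = t\<^sup>2 * (3 - 2 * t)" "1 - smooth_step t = (1 - t)\<^sup>2 * (1 + 2 * t)"
    by (simp_all add: smooth_step_def algebra_simps power2_eq_square power3_eq_cube)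
  moreover have "0 \<le> t\<^sup>2 * (3 - 2 * t)" "0 \<le> (1 - t)\<^sup>2 * (1 + 2 * t)" using t by (auto intro!: mult_nonneg_nonneg)
  ultimately show ?thesis by simp
qed

lemma smooth_step_deriv: "(smooth_step has_vector_derivative 6 * t * (1 - t)) (at t within S)"
  unfolding has_real_derivative_iff_has_vector_derivative[symmetric] smooth_step_def[abs_def]
  by (rule derivative_eq_intros refl | simp add: algebra_simps power2_eq_square)+

locale algebrizable_field = fin_dim_algebra +
  fixes \<Omega> :: "vec3 set" and F F' :: "vec3 \<Rightarrow> vec3"
  assumes open_domain: "open \<Omega>"
    and F_deriv: "\<And>w. w \<in> \<Omega> \<Longrightarrow> (F has_derivative m (F' w)) (at w)"
begin

abbreviation R :: "vec3 set" where "R \<equiv> regular_domain m e F \<Omega>"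

definition G :: "vec3 \<Rightarrow> vec3" where "G w = reciprocal (F w)"

text \<open>The algebra derivative \<open>- F' / F\<^sup>2\<close> of \<open>G = e / F\<close>.\<close>

definition G' :: "vec3 \<Rightarrow> vec3" where "G' w = - m (m (G w) (G w)) (F' w)"

lemma regular_F: "w \<in> R \<Longrightarrow> regular m e (F w)" and R_in_domain: "w \<in> R \<Longrightarrow> w \<in> \<Omega>"
  by (auto simp: regular_domain_def)

lemma G_cancel: "w \<in> R \<Longrightarrow> m (F w) (m (G w) x) = x" "w \<in> R \<Longrightarrow> m (G w) (m (F w) x) = x"
  using regular_F cancel_regular by (auto simp: G_def)

lemma open_R: "open R"
proof -
  have "continuous_on \<Omega> F"
    using F_deriv has_derivative_continuous continuous_at_imp_continuous_on by blast
  then have "open (\<Omega> \<inter> F -` {a. regular m e a})"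
    using open_domain open_regular by (rule continuous_open_preimage)
  moreover have "\<Omega> \<inter> F -` {a. regular m e a} = R" by (auto simp: regular_domain_def)
  ultimately show ?thesis by simp
qed

lemma G_has_derivative:
  assumes "w \<in> R"
  shows "(G has_derivative m (G' w)) (at w)"
proof -
  have "((\<lambda>w. reciprocal (F w)) has_derivative (\<lambda>\<xi>. - m (m (reciprocal (F w)) (reciprocal (F w))) (m (F' w) \<xi>))) (at w)"
    using F_deriv[OF R_in_domain[OF assms]] has_derivative_reciprocal[OF regular_F[OF assms]]
    by (rule has_derivative_compose)
  moreover have "(\<lambda>\<xi>. - m (m (reciprocal (F w)) (reciprocal (F w))) (m (F' w) \<xi>)) = m (G' w)"
    by (simp add: fun_eq_iff G_def G'_def prod.minus_left assoc)
  ultimately show ?thesis by (simp add: G_def[abs_def])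
qed

text \<open>The integrand of \<open>H\<close> as a one-form with values in the algebra.\<close>

definition form :: "vec3 \<Rightarrow> vec3 \<Rightarrow>\<^sub>L vec3" where "form w = Blinfun (m (G w))"

lemma apply_Blinfun_mult [simp]: "blinfun_apply (Blinfun (m a)) = m a"
  by (rule bounded_linear_Blinfun_apply) (rule prod.bounded_linear_right)

lemma bounded_linear_Blinfun_mult: "bounded_linear (\<lambda>a. Blinfun (m a))"
proof -
  have "linear (\<lambda>a. Blinfun (m a))"
    by (rule linearI) (auto intro!: blinfun_eqI simp: blinfun.add_left blinfun.scaleR_left prod.add_left prod.scaleR_left)
  then show ?thesis by (simp add: linear_conv_bounded_linear)
qed

lemma form_apply [simp]: "blinfun_apply (form w) = m (G w)"
  by (simp add: form_def)

lemma form_deriv: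
  assumes "w \<in> R"
  shows "(form has_derivative (\<lambda>\<xi>. Blinfun (m (m (G' w) \<xi>)))) (at w within S)"
  unfolding form_def[abs_def]
  using has_derivative_at_withinI[OF G_has_derivative[OF assms]]
  by (rule bounded_linear.has_derivative[OF bounded_linear_Blinfun_mult])

lemma continuous_on_form: "S \<subseteq> R \<Longrightarrow> continuous_on S form"
  using form_deriv by (intro has_derivative_continuous_on) blast

text \<open>The derivative of the form sends \<open>\<xi>\<close>, \<open>\<eta>\<close> to the product of \<open>G'\<close>, \<open>\<xi>\<close> and \<open>\<eta>\<close>. It is symmetric because the
  algebra is commutative and associative: algebrizable fields give closed forms.\<close>

lemma local_primitive:
  assumes "convex S" "S \<subseteq> R"
  obtains h where "\<And>x. x \<in> S \<Longrightarrow> (h has_derivative m (G x)) (at x within S)"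
proof (rule closed_form_has_primitive[OF assms(1)])
  show "(form has_derivative (\<lambda>\<xi>. Blinfun (m (m (G' x) \<xi>)))) (at x within S)" if "x \<in> S" for x
    using that assms by (auto intro: form_deriv)
  show "blinfun_apply (Blinfun (m (m (G' x) \<xi>))) \<eta> = blinfun_apply (Blinfun (m (m (G' x) \<eta>))) \<xi>" for x \<xi> \<eta>
    by (simp add: ac)
qed (use that in auto)

lemma has_line_integralI:
  assumes "a > 0"
    and "\<And>t. t \<in> {0..a} \<Longrightarrow> (\<gamma> has_vector_derivative \<gamma>' t) (at t within {0..a})"
    and "((\<lambda>t. m (G (\<gamma> t)) (\<gamma>' t)) has_integral I) {0..a}"
  shows "has_line_integral m e F a \<gamma> I"
  unfolding has_line_integral_def
  using assms(3)
  by (rule has_integral_eq[rotated])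
     (simp add: G_def vector_derivative_within_closed_interval[OF assms(1) _ assms(2)])

lemma has_integral_primitive_along:
  assumes h: "\<And>x. x \<in> U \<Longrightarrow> (h has_derivative m (G x)) (at x within U)"
    and "a \<le> c" and \<gamma>: "\<And>t. t \<in> {a..c} \<Longrightarrow> (\<gamma> has_vector_derivative \<gamma>' t) (at t within {a..c})"
    and U: "\<gamma> ` {a..c} \<subseteq> U"
  shows "((\<lambda>t. m (G (\<gamma> t)) (\<gamma>' t)) has_integral h (\<gamma> c) - h (\<gamma> a)) {a..c}"
proof (rule fundamental_theorem_of_calculus[OF \<open>a \<le> c\<close>])
  fix t assume t: "t \<in> {a..c}"
  have "(h has_derivative m (G (\<gamma> t))) (at (\<gamma> t) within \<gamma> ` {a..c})"
    using U t by (intro has_derivative_subset[OF h]) auto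
  then show "((\<lambda>t. h (\<gamma> t)) has_vector_derivative m (G (\<gamma> t)) (\<gamma>' t)) (at t within {a..c})"
    using vector_derivative_diff_chain_within[OF \<gamma>[OF t]] by (simp add: o_def)
qed

text \<open>The fundamental theorem of calculus for the gauge integral accepts every differentiable curve. A curve
  with parameter interval \<open>{0..0}\<close> needs its own case, since vector derivatives are not unique there.\<close>

lemma has_line_integral_primitive:
  assumes h: "\<And>x. x \<in> U \<Longrightarrow> (h has_derivative m (G x)) (at x within U)"
    and \<gamma>: "curve_in U a \<gamma>"
  shows "has_line_integral m e F a \<gamma> (h (\<gamma> a) - h (\<gamma> 0))"
proof (cases "a = 0")
  case True
  then show ?thesis by (simp add: has_line_integral_def has_integral_refl)
next
  case False
  with \<gamma> have a: "a > 0" by (simp add: curve_in_def)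
  have d: "(\<gamma> has_vector_derivative vector_derivative \<gamma> (at t within {0..a})) (at t within {0..a})" if "t \<in> {0..a}" for t
    using \<gamma> that by (simp add: curve_in_def differentiable_on_def vector_derivative_works[symmetric])
  show ?thesis
    using \<gamma> a by (intro has_line_integralI[OF a d] has_integral_primitive_along[OF h _ d]) (auto simp: curve_in_def)
qed

text \<open>Testing coherence of a branch on the segments starting at \<open>w\<close> determines its derivative.\<close>

lemma H_branch_has_derivative:
  assumes H: "H_branch m e F \<Omega> b U h" and w: "w \<in> U"
  shows "(h has_derivative m (G w)) (at w)"
proof -
  have U: "open U" "U \<subseteq> R" using H by (auto simp: H_branch_def)
  then obtain r where "r > 0" and r: "ball w r \<subseteq> U" using w open_contains_ball by blast
  have "(h has_derivative blinfun_apply (form w)) (at w within ball w r)"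
  proof (rule has_derivative_of_segment_integrals)
    show "continuous_on (ball w r) form" using r U by (intro continuous_on_form) auto
    fix y assume y: "y \<in> ball w r"
    define \<gamma> where "\<gamma> t = w + t *\<^sub>R (y - w)" for t
    have d: "(\<gamma> has_vector_derivative (y - w)) (at t within {0..1})" for t
      unfolding \<gamma>_def by (auto intro!: derivative_eq_intros)
    have "\<gamma> ` {0..1} \<subseteq> ball w r"
      using segment_point_in_convex[OF convex_ball _ y] \<open>r > 0\<close> by (auto simp: \<gamma>_def)
    then have "curve_in U 1 \<gamma>"
      using r d unfolding curve_in_def differentiable_on_def
      by (auto intro: differentiableI_vector)
    then have "has_line_integral m e F 1 \<gamma> (h (\<gamma> 1) - h (\<gamma> 0))"
      using H by (simp add: H_branch_def)
    then have "((\<lambda>t. m (G (\<gamma> t)) (y - w)) has_integral h y - h w) {0..1}"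
      unfolding has_line_integral_def
      by (rule has_integral_eq[rotated, THEN has_integral_eq_rhs])
         (simp_all add: G_def vector_derivative_within_closed_interval[OF _ _ d] \<gamma>_def)
    then show "h y - h w = segment_integral form w y"
      by (simp add: segment_integral_def \<gamma>_def integral_unique)
  qed (use \<open>r > 0\<close> in auto)
  then show ?thesis using at_within_open[of w "ball w r"] \<open>r > 0\<close> by simp
qed

text \<open>In an open connected set two points are joined by a polynomial curve, along which the integral of
  \<open>G\<close> exists. Reparametrisation makes it come to rest at \<open>w\<close>.\<close>

lemma curve_with_stop:
  assumes "connected_component R w p"
  obtains \<gamma> \<gamma>' I where "\<gamma> 0 = p" "\<gamma> 1 = w" "\<gamma>' 1 = 0" "\<gamma> ` {0..1} \<subseteq> R"
    "\<And>t. (\<gamma> has_vector_derivative \<gamma>' t) (at t)"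
    "((\<lambda>t. m (G (\<gamma> t)) (\<gamma>' t)) has_integral I) {0..1::real}"
proof -
  let ?C = "connected_component_set R w"
  have C: "open ?C" "connected ?C" "p \<in> ?C" "w \<in> ?C" "?C \<subseteq> R"
    using assms open_R connected_component_in[OF assms]
    by (auto simp: open_connected_component connected_component_refl connected_component_subset)
  obtain g where g: "polynomial_function g" "path_image g \<subseteq> ?C" "pathstart g = p" "pathfinish g = w"
    using connected_open_polynomial_connected[OF C(1-4)] by blast
  obtain g' where g': "polynomial_function g'" "\<And>x. (g has_vector_derivative g' x) (at x)"
    using has_vector_derivative_polynomial_function[OF g(1)] by blast
  define \<gamma> where "\<gamma> t = g (smooth_step t)" for t
  define \<gamma>' where "\<gamma>' t = (6 * t * (1 - t)) *\<^sub>R g' (smooth_step t)" for t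
  have img: "\<gamma> ` {0..1} \<subseteq> R"
    using g(2) C(5) smooth_step_in_unit unfolding \<gamma>_def path_image_def by blast
  have d: "(\<gamma> has_vector_derivative \<gamma>' t) (at t)" for t
    using vector_diff_chain_at[OF smooth_step_deriv[of t UNIV] g'(2)]
    by (simp add: \<gamma>_def[abs_def] \<gamma>'_def o_def)
  have "continuous_on {0..1} smooth_step" "continuous_on UNIV g'"
    using g'(1) continuous_on_polymonial_function
    by (auto simp: smooth_step_def[abs_def] intro!: continuous_intros)
  then have "continuous_on {0..1} (\<lambda>t. g' (smooth_step t))"
    using continuous_on_compose2[of UNIV g' "{0..1}" smooth_step] by blast
  then have "continuous_on {0..1} \<gamma>'"
    unfolding \<gamma>'_def by (intro continuous_intros)
  moreover have "continuous_on {0..1} (\<lambda>t. G (\<gamma> t))"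
  proof (rule continuous_on_compose2[OF _ _ img])
    show "continuous_on R G"
      using G_has_derivative has_derivative_at_withinI by (intro has_derivative_continuous_on) blast
    show "continuous_on {0..1} \<gamma>"
      by (rule continuous_on_vector_derivative[OF has_vector_derivative_at_within[OF d]])
  qed
  ultimately have "continuous_on {0..1} (\<lambda>t. m (G (\<gamma> t)) (\<gamma>' t))" by (intro prod.continuous_on)
  then have "(\<lambda>t. m (G (\<gamma> t)) (\<gamma>' t)) integrable_on {0..1}" by (rule integrable_continuous_interval)
  then show ?thesis
    using img d g(3,4) by (intro that[of \<gamma> \<gamma>']) (auto simp: \<gamma>_def \<gamma>'_def pathstart_def pathfinish_def integrable_integral)
qed

text \<open>On a ball around \<open>w\<close> the branch is a primitive, normalised at \<open>w\<close> by the integral over one curve from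
  the base point. Its value at another point \<open>x\<close> of the ball must be an integral over a single
  differentiable curve from the base point to \<open>x\<close>: the chosen curve to \<open>w\<close>, followed by the segment from \<open>w\<close> to
  \<open>x\<close>, both at rest where they meet.\<close>

lemma H_branch_exists:
  assumes b: "base_points R b" and w: "w \<in> R"
  obtains U h where "H_branch m e F \<Omega> b U h" "w \<in> U"
proof -
  obtain r where "r > 0" and r: "ball w r \<subseteq> R" using w open_R open_contains_ball by blast
  let ?U = "ball w r"
  obtain h\<^sub>0 where h\<^sub>0: "\<And>x. x \<in> ?U \<Longrightarrow> (h\<^sub>0 has_derivative m (G x)) (at x within ?U)"
    using local_primitive[OF convex_ball r] by blast
  have "connected_component R w (b w)" using b w by (auto simp: base_points_def)
  then obtain \<gamma> \<gamma>' I where \<gamma>: "\<gamma> 0 = b w" "\<gamma> 1 = w" "\<gamma>' 1 = 0" "\<gamma> ` {0..1} \<subseteq> R"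
    "\<And>t. (\<gamma> has_vector_derivative \<gamma>' t) (at t)"
    "((\<lambda>t. m (G (\<gamma> t)) (\<gamma>' t)) has_integral I) {0..1::real}"
    by (rule curve_with_stop) blast
  define h where "h x = h\<^sub>0 x - h\<^sub>0 w + I" for x
  have h: "(h has_derivative m (G x)) (at x within ?U)" if "x \<in> ?U" for x
    unfolding h_def using h\<^sub>0[OF that] by (auto intro!: derivative_eq_intros)
  have "h x \<in> H_values m e F \<Omega> b x" if x: "x \<in> ?U" for x
  proof -
    have "connected_component R w x"
      unfolding connected_component_def using x \<open>r > 0\<close> r by (intro exI[of _ ?U]) auto
    then have bx: "b x = b w" using b by (auto simp: base_points_def)
    define \<eta> where "\<eta> t = w + smooth_step (t - 1) *\<^sub>R (x - w)" for t
    define \<eta>' where "\<eta>' t = (6 * (t - 1) * (1 - (t - 1))) *\<^sub>R (x - w)" for t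
    have \<eta>: "(\<eta> has_vector_derivative \<eta>' t) (at t within S)" for t S
    proof -
      have "((\<lambda>t. t - 1) has_vector_derivative 1) (at t within S)"
        by (auto intro!: derivative_eq_intros)
      then have "((\<lambda>t. smooth_step (t - 1)) has_vector_derivative 6 * (t - 1) * (1 - (t - 1))) (at t within S)"
        using vector_diff_chain_within[OF _ smooth_step_deriv] by (fastforce simp: o_def)
      then show ?thesis
        using has_vector_derivative_add[OF has_vector_derivative_const
          bounded_linear.has_vector_derivative[OF bounded_linear_scaleR_left]]
        unfolding \<eta>_def \<eta>'_def by fastforce
    qed
    have \<eta>U: "\<eta> ` {1..2} \<subseteq> ?U"
    proof (rule image_subsetI)
      fix t :: real assume "t \<in> {1..2}"
      then have "smooth_step (t - 1) \<in> {0..1}" by (intro smooth_step_in_unit) auto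
      then show "\<eta> t \<in> ?U"
        unfolding \<eta>_def using x \<open>r > 0\<close> by (intro segment_point_in_convex) auto
    qed
    define \<delta> where "\<delta> t = (if t \<in> {0..1} then \<gamma> t else \<eta> t)" for t
    define \<delta>' where "\<delta>' t = (if t \<in> {0..1} then \<gamma>' t else \<eta>' t)" for t
    have \<delta>\<eta>: "\<delta> t = \<eta> t" "\<delta>' t = \<eta>' t" if "t \<in> {1..2}" for t
      using that \<gamma> by (auto simp: \<delta>_def \<delta>'_def \<eta>_def \<eta>'_def)
    have \<delta>: "(\<delta> has_vector_derivative \<delta>' t) (at t within {0..2})" if "t \<in> {0..2}" for t
      unfolding \<delta>_def \<delta>'_def
    proof (rule has_vector_derivative_If_within_closures)
      show "t \<in> {0..1} \<union> {1..2}" "{0..2} = {0..1} \<union> {1..2::real}" using that by auto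
      show "(\<gamma> has_vector_derivative \<gamma>' t) (at t within T)" for T
        using \<gamma>(5) by (rule has_vector_derivative_at_within)
      show "\<gamma> t = \<eta> t" "\<gamma>' t = \<eta>' t" if "t \<in> closure {0..1}" "t \<in> closure {1..2}"
        using that \<gamma> by (auto simp: \<eta>_def \<eta>'_def)
    qed (rule \<eta>)
    have "((\<lambda>t. m (G (\<delta> t)) (\<delta>' t)) has_integral I) {0..1}"
      using \<gamma>(6) by (rule has_integral_eq[rotated]) (simp add: \<delta>_def \<delta>'_def)
    moreover have "((\<lambda>t. m (G (\<eta> t)) (\<eta>' t)) has_integral h (\<eta> 2) - h (\<eta> 1)) {1..2}"
      using h \<eta> \<eta>U by (intro has_integral_primitive_along) auto
    then have "((\<lambda>t. m (G (\<delta> t)) (\<delta>' t)) has_integral h (\<eta> 2) - h (\<eta> 1)) {1..2}"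
      by (rule has_integral_eq[rotated]) (simp add: \<delta>\<eta>)
    ultimately have "((\<lambda>t. m (G (\<delta> t)) (\<delta>' t)) has_integral I + (h (\<eta> 2) - h (\<eta> 1))) {0..2}"
      by (rule has_integral_combine[rotated 2]) auto
    then have "((\<lambda>t. m (G (\<delta> t)) (\<delta>' t)) has_integral h x) {0..2}"
      by (simp add: \<eta>_def h_def add.commute)
    then have "has_line_integral m e F 2 \<delta> (h x)"
      by (intro has_line_integralI[OF _ \<delta>]) auto
    moreover have "curve_in R 2 \<delta>"
    proof -
      have "\<delta> t \<in> R" if "t \<in> {0..2}" for t
      proof (cases "t \<in> {0..1}")
        case True
        then show ?thesis using \<gamma>(4) by (auto simp: \<delta>_def)
      next
        case False
        then have "\<delta> t = \<eta> t" "t \<in> {1..2}" using that by (auto simp: \<delta>_def)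
        then show ?thesis using \<eta>U r by (auto simp: image_subset_iff)
      qed
      then show ?thesis
        using differentiableI_vector[OF \<delta>] unfolding curve_in_def differentiable_on_def by auto
    qed
    moreover have "\<delta> 0 = b x" "\<delta> 2 = x"
      using \<gamma>(1) bx by (auto simp: \<delta>_def \<eta>_def)
    ultimately show ?thesis unfolding H_values_def by blast
  qed
  then have "H_branch m e F \<Omega> b ?U h"
    unfolding H_branch_def using r by (auto intro: has_line_integral_primitive[OF h])
  then show ?thesis using that \<open>r > 0\<close> by simp
qed

lemma H_pullback_eq:
  assumes b: "base_points R b" and w: "w \<in> R"
  shows "H_pullback m e F \<Omega> b w x y = m (G w) x \<bullet> m (G w) y"
proof -
  have "pullback_euclidean h w x y = m (G w) x \<bullet> m (G w) y" if "H_branch m e F \<Omega> b U h" "w \<in> U" for U h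
    using frechet_derivative_at[OF H_branch_has_derivative[OF that]]
    by (simp add: pullback_euclidean_def)
  moreover obtain U h where "H_branch m e F \<Omega> b U h" "w \<in> U"
    using H_branch_exists[OF assms] .
  ultimately show ?thesis
    unfolding H_pullback_def by (intro the_equality) metis+
qed

end

section \<open>The pulled-back metric and its geodesics\<close>

lemma matrix_inv_mult_vec:
  fixes A :: "real ^ 'n ^ 'n"
  assumes "\<And>x. A *v x = 0 \<Longrightarrow> x = 0"
  shows "matrix_inv A *v (A *v x) = x"
proof -
  have "invertible A"
    using assms matrix_left_invertible_ker[of A] invertible_left_inverse by blast
  then have "matrix_inv A ** A = mat 1"
    unfolding invertible_def matrix_inv_def by (rule someI2_ex) simp
  then show ?thesis
    by (simp add: matrix_vector_mul_assoc)
qed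

context algebrizable_field
begin

context
  fixes b
  assumes base: "base_points R b"
begin

abbreviation g :: metric3 where "g \<equiv> H_metric m e F \<Omega> b"

lemma g_eq: "w \<in> R \<Longrightarrow> g w x y = 1 / (norm e)\<^sup>2 * (m (G w) x \<bullet> m (G w) y)"
  by (simp add: H_metric_def H_pullback_eq[OF base])

lemma g_bilinear: "w \<in> R \<Longrightarrow> bilinear (g w)"
  by (simp add: bilinear_def g_eq linear_iff prod.add_right prod.scaleR_right inner_left_distrib
      inner_right_distrib distrib_left add_divide_distrib)

lemma g_positive:
  assumes "w \<in> R" "x \<noteq> 0"
  shows "g w x x > 0"
proof -
  have "m (G w) x \<noteq> 0" using assms G_cancel(1)[of w x] prod.zero_right by metis
  then show ?thesis using assms unit_nonzero by (simp add: g_eq)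
qed

lemma gram_has_derivative:
  assumes "w \<in> R"
  shows "((\<lambda>z. gram g z $ i $ j) has_derivative
    (\<lambda>\<xi>. 1 / (norm e)\<^sup>2 * (m (G w) (axis i 1) \<bullet> m (m (G' w) \<xi>) (axis j 1) +
                              m (m (G' w) \<xi>) (axis i 1) \<bullet> m (G w) (axis j 1)))) (at w)"
proof -
  have "((\<lambda>z. m (G z) v) has_derivative (\<lambda>\<xi>. m (m (G' w) \<xi>) v)) (at w)" for v
    using bounded_linear.has_derivative[OF prod.bounded_linear_left G_has_derivative[OF assms]] .
  then have "((\<lambda>z. 1 / (norm e)\<^sup>2 * (m (G z) (axis i 1) \<bullet> m (G z) (axis j 1))) has_derivative
    (\<lambda>\<xi>. 1 / (norm e)\<^sup>2 * (m (G w) (axis i 1) \<bullet> m (m (G' w) \<xi>) (axis j 1) +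
                              m (m (G' w) \<xi>) (axis i 1) \<bullet> m (G w) (axis j 1)))) (at w)"
    by (intro has_derivative_mult_right has_derivative_inner)
  then show ?thesis
    by (rule has_derivative_transform_within_open[OF _ open_R assms]) (simp add: gram_def g_eq)
qed

lemma riemannian_g: "riemannian_metric_on R g"
  unfolding riemannian_metric_on_def
proof (intro ballI conjI allI impI)
  fix w assume w: "w \<in> R"
  show "bilinear (g w)" using w by (rule g_bilinear)
  show "g w x y = g w y x" for x y using w by (simp add: g_eq inner_commute)
  show "g w x x > 0" if "x \<noteq> 0" for x using w that by (rule g_positive)
  show "(\<lambda>z. gram g z $ i $ j) differentiable at w" for i j
    using gram_has_derivative[OF w] by (auto simp only: differentiable_def)
qed

lemma gram_partial_eq:
  assumes "w \<in> R"
  shows "gram_partial g l i j w = 1 / (norm e)\<^sup>2 *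
    (m (G w) (axis i 1) \<bullet> m (m (G' w) (axis l 1)) (axis j 1) +
     m (m (G' w) (axis l 1)) (axis i 1) \<bullet> m (G w) (axis j 1))"
  unfolding gram_partial_def by (simp flip: frechet_derivative_at[OF gram_has_derivative[OF assms]])

lemma gram_mult_vec:
  assumes "w \<in> R"
  shows "(gram g w *v x) $ l = g w (axis l 1) x"
proof -
  have "g w (axis l 1) x = g w (axis l 1) (\<Sum>j\<in>UNIV. x $ j *\<^sub>R axis j 1)"
    by (simp add: basis_expansion flip: scalar_mult_eq_scaleR)
  also have "\<dots> = (\<Sum>j\<in>UNIV. x $ j *\<^sub>R g w (axis l 1) (axis j 1))"
    using g_bilinear[OF assms] by (simp add: bilinear_def linear_sum linear_cmul)
  finally show ?thesis
    by (simp add: matrix_vector_mult_def gram_def mult.commute)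
qed

text \<open>The derivative of \<open>w \<mapsto> m (G w) y\<close> in direction \<open>x\<close> is the product of \<open>G'\<close>, \<open>x\<close> and \<open>y\<close>, symmetric in \<open>x\<close> and
  \<open>y\<close>. Of the six terms in the combination of three partial derivatives four cancel, and what remains is
  twice the inner product, with respect to the metric, of a basis vector with \<open>z = (G' / G) e\<^sub>i e\<^sub>j\<close>. The inverse Gram matrix then
  returns \<open>z\<close>, and \<open>G' / G = - F' / F\<close>.\<close>

lemma christoffel_eq:
  assumes w: "w \<in> R"
  shows "christoffel g k i j w = - m (m (G w) (F' w)) (m (axis i 1) (axis j 1)) $ k"
proof -
  define z where "z = - m (m (G w) (F' w)) (m (axis i 1) (axis j 1))"
  have Gz: "m (G w) z = m (m (G' w) (axis i 1)) (axis j 1)"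
    by (simp add: z_def G'_def prod.minus_right prod.minus_left assoc)
  have sym: "m (m (G' w) (axis p 1)) (axis q 1) = m (m (G' w) (axis q 1)) (axis p 1)" for p q
    by (simp add: ac)
  have "gram_partial g i j l w + gram_partial g j i l w - gram_partial g l i j w = 2 * (gram g w *v z) $ l" for l
    unfolding gram_mult_vec[OF w] gram_partial_eq[OF w] g_eq[OF w] Gz
      sym[of l i] sym[of l j] sym[of j i]
    by (simp add: inner_commute algebra_simps)
  then have "christoffel g k i j w = (matrix_inv (gram g w) *v (gram g w *v z)) $ k"
    by (simp add: christoffel_def matrix_vector_mult_def[of "matrix_inv (gram g w)"] sum_distrib_left mult.left_commute)
  also have "matrix_inv (gram g w) *v (gram g w *v z) = z"
  proof (rule matrix_inv_mult_vec)
    fix x assume x: "gram g w *v x = 0"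
    have "g w x x = x \<bullet> (gram g w *v x)"
    proof -
      have "g w x x = g w (\<Sum>l\<in>UNIV. x $ l *\<^sub>R axis l 1) x"
        by (simp add: basis_expansion flip: scalar_mult_eq_scaleR)
      also have "\<dots> = (\<Sum>l\<in>UNIV. x $ l * g w (axis l 1) x)"
        using g_bilinear[OF w] by (simp add: bilinear_def linear_sum[of "\<lambda>u. g w u x"] linear_cmul[of "\<lambda>u. g w u x"])
      finally show ?thesis by (simp add: inner_vec_def gram_mult_vec[OF w])
    qed
    then show "x = 0" using g_positive[OF w, of x] x by (cases "x = 0") auto
  qed
  finally show ?thesis by (simp add: z_def)
qed

lemma christoffel_sum:
  assumes w: "w \<in> R"
  shows "(\<Sum>i\<in>UNIV. \<Sum>j\<in>UNIV. christoffel g k i j w * x $ i * y $ j) = - m (m (G w) (F' w)) (m x y) $ k"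
proof -
  have expand: "(\<Sum>i\<in>UNIV. v $ i *\<^sub>R axis i 1) = v" for v :: vec3
    by (simp add: basis_expansion flip: scalar_mult_eq_scaleR)
  let ?c = "m (G w) (F' w)"
  have "m ?c (m x y) = m ?c (m (\<Sum>i\<in>UNIV. x $ i *\<^sub>R axis i 1) (\<Sum>j\<in>UNIV. y $ j *\<^sub>R axis j 1))"
    by (simp only: expand)
  also have "\<dots> = (\<Sum>i\<in>UNIV. \<Sum>j\<in>UNIV. (x $ i * y $ j) *\<^sub>R m ?c (m (axis i 1) (axis j 1)))"
    unfolding prod.sum_left
    by (simp add: prod.sum_right prod.scaleR_left prod.scaleR_right scaleR_sum_right mult.commute)
  finally show ?thesis
    by (simp add: christoffel_eq[OF w] sum_component mult_ac sum_negf)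
qed

text \<open>Along an integral curve of \<open>u F\<close> the acceleration is \<open>u F' (u F)\<close>, while the Christoffel term is
  \<open>- (F' / F) (u F) (u F)\<close>; commutativity makes them cancel. The speed is constant because
  \<open>G\<close> maps \<open>u F\<close> to the constant vector \<open>u\<close>.\<close>

lemma multiple_geodesible:
  "geodesible_with_speed (norm u / norm e) g R (\<lambda>w. m u (F w))"
  unfolding geodesible_with_speed_def
proof (intro conjI allI impI riemannian_g)
  fix J \<gamma> assume \<gamma>: "integral_curve R (\<lambda>w. m u (F w)) J \<gamma>"
  show "geodesic_with_speed (norm u / norm e) g J \<gamma>"
    unfolding geodesic_with_speed_def
  proof (intro exI ballI conjI allI)
    fix t assume t: "t \<in> J"
    let ?p = "\<gamma> t"
    have p: "?p \<in> R" and d: "(\<gamma> has_vector_derivative m u (F ?p)) (at t)"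
      using \<gamma> t by (auto simp: integral_curve_def)
    show "(\<gamma> has_vector_derivative m u (F ?p)) (at t)" by (rule d)
    have "((\<lambda>w. m u (F w)) has_derivative (\<lambda>\<xi>. m u (m (F' ?p) \<xi>))) (at ?p)"
      using bounded_linear.has_derivative[OF prod.bounded_linear_right F_deriv[OF R_in_domain[OF p]]] .
    then have "((\<lambda>w. m u (F w)) has_derivative (\<lambda>\<xi>. m u (m (F' ?p) \<xi>))) (at ?p within range \<gamma>)"
      by (rule has_derivative_at_withinI)
    then show "((\<lambda>t. m u (F (\<gamma> t))) has_vector_derivative m u (m (F' ?p) (m u (F ?p)))) (at t)"
      using vector_derivative_diff_chain_within[OF d] by (simp add: o_def)
    fix k
    have "m (m (G ?p) (F' ?p)) (m (m u (F ?p)) (m u (F ?p))) = m (F ?p) (m (G ?p) (m u (m (F' ?p) (m u (F ?p)))))"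
      by (simp add: ac)
    also have "\<dots> = m u (m (F' ?p) (m u (F ?p)))" using G_cancel(1)[OF p] .
    finally show "m u (m (F' ?p) (m u (F ?p))) $ k +
       (\<Sum>i\<in>UNIV. \<Sum>j\<in>UNIV. christoffel g k i j ?p * m u (F ?p) $ i * m u (F ?p) $ j) = 0"
      by (simp add: christoffel_sum[OF p])
    have "m (G ?p) (m u (F ?p)) = u" using G_cancel(2)[OF p, of u] by (simp add: ac)
    then show "sqrt (g ?p (m u (F ?p)) (m u (F ?p))) = norm u / norm e"
      by (simp add: g_eq[OF p] power2_norm_eq_inner[symmetric] real_sqrt_divide)
  qed
qed

end

lemma multiples_commute:
  assumes "w \<in> \<Omega>"
  shows "lie_bracket (\<lambda>w. m u (F w)) (\<lambda>w. m v (F w)) w = 0"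
proof -
  have "frechet_derivative (\<lambda>w. m u (F w)) (at w) = (\<lambda>\<xi>. m u (m (F' w) \<xi>))" for u
    using frechet_derivative_at[OF bounded_linear.has_derivative[OF prod.bounded_linear_right F_deriv[OF assms]]]
    by metis
  then show ?thesis by (simp add: lie_bracket_def ac)
qed

end

section \<open>The sphere of multiples of the field\<close>

lemma norm_sphere_point: "norm (sphere_point \<theta> \<phi>) = 1"
proof -
  have "(cos \<theta> * sin \<phi>)\<^sup>2 + (sin \<theta> * sin \<phi>)\<^sup>2 + (cos \<phi>)\<^sup>2 = ((cos \<theta>)\<^sup>2 + (sin \<theta>)\<^sup>2) * (sin \<phi>)\<^sup>2 + (cos \<phi>)\<^sup>2"
    by (simp only: power_mult_distrib distrib_right)
  also have "\<dots> = 1" by simp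
  finally show ?thesis
    by (simp add: norm_vec_def L2_set_def sum_3 sphere_point_def)
qed

lemma axis_as_sphere_point:
  "axis 1 1 = sphere_point 0 (pi / 2)"
  "axis 2 1 = sphere_point (pi / 2) (pi / 2)"
  "axis 3 1 = sphere_point 0 0"
  by (simp_all add: vec_eq_iff forall_3 axis_def sphere_point_def)

theorem proposition5p3:
  fixes m :: "real ^ 3 \<Rightarrow> real ^ 3 \<Rightarrow> real ^ 3" and e :: "real ^ 3"
    and \<Omega> :: "(real ^ 3) set" and F b :: "real ^ 3 \<Rightarrow> real ^ 3"
  assumes "algebra3 m e"
    and "open \<Omega>"
    and "algebrizable_on m \<Omega> F"
    and "base_points (regular_domain m e F \<Omega>) b"
  shows "(\<forall>K\<in>field_family m F.
            geodesible_with_speed (1 / norm e) (H_metric m e F \<Omega> b) (regular_domain m e F \<Omega>) K) \<and>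
         (norm e = 1 \<longrightarrow>
            (\<forall>K\<in>field_family m F.
               geodesible (H_metric m e F \<Omega> b) (regular_domain m e F \<Omega>) K)) \<and>
         {coordinate_field m F 1, coordinate_field m F 2, coordinate_field m F 3} =
           {rotated_field m F 0 (pi / 2), rotated_field m F (pi / 2) (pi / 2), rotated_field m F 0 0} \<and>
         commutative_family_on \<Omega> (field_family m F)"
proof -
  obtain F' where F': "\<forall>w\<in>\<Omega>. (F has_derivative m (F' w)) (at w)"
    using assms(3) by (auto simp: algebrizable_on_def)
  interpret algebrizable_field m e \<Omega> F F'
    using assms(1,2) F' by unfold_locales auto
  have geodesible: "\<forall>K\<in>field_family m F. geodesible_with_speed (1 / norm e) (H_metric m e F \<Omega> b) R K"
    using multiple_geodesible[OF assms(4), of "sphere_point \<theta> \<phi>" for \<theta> \<phi>]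
    by (auto simp: field_family_def rotated_field_def norm_sphere_point)
  moreover have "norm e = 1 \<longrightarrow> (\<forall>K\<in>field_family m F. geodesible (H_metric m e F \<Omega> b) R K)"
    using geodesible by (auto simp: geodesible_def)
  moreover have "{coordinate_field m F 1, coordinate_field m F 2, coordinate_field m F 3} =
      {rotated_field m F 0 (pi / 2), rotated_field m F (pi / 2) (pi / 2), rotated_field m F 0 0}"
    by (simp add: coordinate_field_def rotated_field_def axis_as_sphere_point)
  moreover have "commutative_family_on \<Omega> (field_family m F)"
    using multiples_commute by (auto simp: commutative_family_on_def field_family_def rotated_field_def)
  ultimately show ?thesis by blast
qed

end
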